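(* For nil$_2$-groups $G$ and $H$ and a homomorphism $f:G\to H^{\mathrm{ab}}$, there is a well-defined element $o(f)\in\mathsf{Quad}^1(G,[H,H])$ (the image of $f$ under the connecting map $\mathrm{Hom}(G,H^{\mathrm{ab}})\to\mathsf{Quad}^1(G,[H,H])$) which vanishes if and only if $f$ lifts to a q-map $G\to H$, i.e. there is a q-map $G\to H$ whose composite with the projection $H\to H^{\mathrm{ab}}$ equals $f$.
   Context: Groups are written additively; $[a,b]=-a-b+a+b$. A nil$_2$-group is a group $G$ with $[[G,G],G]=0$; $\mathbf{Nil}$ is the category of nil$_2$-groups and homomorphisms; $G^{\mathrm{ab}}=G/[G,G]$. For a map $f:G\to H$ put $(a\mid b)_f:=-(f(a)+f(b))+f(a+b)$. The map $f$ is weakly quadratic if for all $a,b,c\in G$ the element $(a\mid b)_f$ commutes with $f(c)$ and is additive in $a$ and in $b$; it is quadratic if moreover $(a\mid b)_f$ is central in $H$. $\mathsf{Quad}(G,H)$ is the set of quadratic maps, a group under pointwise addition for $H$ nil$_2$ (abelian if $H$ is abelian). A q-map is a weakly quadratic map $f:G\to H$ between nil$_2$-groups with $(a\mid b)_f\in[H,H]$ for all $a,b$; $\mathsf Q(G,H)$ is the group of q-maps under pointwise addition. A free simplicial resolution of $G\in\mathbf{Nil}$ is a simplicial object $G_*$ in $\mathbf{Nil}$ with every $G_n$ free in $\mathbf{Nil}$, $\pi_i(G_* )=0$ for $i>0$ and $\pi_0(G_* )=G$. For an abelian group $A$, $\mathsf{Quad}^i(G,A):=\pi^i(\mathsf{Quad}(G_*,A))$,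 the $i$-th cohomology of the cochain complex (differential $\sum(-1)^jd^j$) of the cosimplicial abelian group $\mathsf{Quad}(G_*,A)$; it does not depend on the choice of $G_*$. The connecting map $\mathrm{Hom}(G,H^{\mathrm{ab}})\to\mathsf{Quad}^1(G,[H,H])$ arises from the short exact sequence of cosimplicial groups $0\to\mathsf{Quad}(G_*,[H,H])\to\mathsf Q(G_*,H)\to\mathrm{Hom}(G_*,H^{\mathrm{ab}})\to0$: given $f:G\to H^{\mathrm{ab}}$, choose a q-map $\varphi:G_0\to H$ lifting the composite $G_0\to G\xrightarrow{f}H^{\mathrm{ab}}$; with $d_0,d_1:G_1\to G_0$ the face maps, the map $-\varphi d_0+\varphi d_1$ takes values in $[H,H]$ and its class in $\mathsf{Quad}^1(G,[H,H])$ is the image of $f$. *)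

theory Defs
  imports "HOL-Algebra.Generated_Groups" "HOL-Algebra.FiniteProduct"
begin

text \<open>Groups are HOL-Algebra groups, hence written multiplicatively. All conditions on maps refer
  to carriers only.\<close>

section \<open>Groups of nilpotency class two\<close>

definition commutator :: "('a, 'm) monoid_scheme \<Rightarrow> 'a \<Rightarrow> 'a \<Rightarrow> 'a" where
  "commutator G a b = inv\<^bsub>G\<^esub> a \<otimes>\<^bsub>G\<^esub> inv\<^bsub>G\<^esub> b \<otimes>\<^bsub>G\<^esub> a \<otimes>\<^bsub>G\<^esub> b"

definition nil2_group :: "('a, 'm) monoid_scheme \<Rightarrow> bool" where
  "nil2_group G \<longleftrightarrow> group G \<and>
     generate G {commutator G a b | a b. a \<in> derived G (carrier G) \<and> b \<in> carrier G} = {\<one>\<^bsub>G\<^esub>}"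

definition commutator_group :: "'a monoid \<Rightarrow> 'a monoid" where
  "commutator_group G = G\<lparr>carrier := derived G (carrier G)\<rparr>"

definition abelianization :: "'a monoid \<Rightarrow> 'a set monoid" where
  "abelianization G = G Mod derived G (carrier G)"

definition ab_proj :: "'a monoid \<Rightarrow> 'a \<Rightarrow> 'a set" where
  "ab_proj G a = derived G (carrier G) #>\<^bsub>G\<^esub> a"


section \<open>Free nil2-groups\<close>

text \<open>A word is a list of letters \<open>(True, x)\<close>, standing for the generator \<open>x\<close>, and \<open>(False, x)\<close>,
  standing for its inverse. The free nil2-group on \<open>X\<close> is the quotient of the words by the least
  congruence that makes formal inverses inverse and kills all triple commutators; its universal
  property with respect to nil2-groups on arbitrary types is
  \<open>free_nil2_group_universal\<close> below.\<close>

definition word_set :: "'x set \<Rightarrow> (bool \<times> 'x) list set" where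
  "word_set X = lists (UNIV \<times> X)"

definition word_inv :: "(bool \<times> 'x) list \<Rightarrow> (bool \<times> 'x) list" where
  "word_inv w = rev (map (\<lambda>(b, x). (\<not> b, x)) w)"

definition word_comm :: "(bool \<times> 'x) list \<Rightarrow> (bool \<times> 'x) list \<Rightarrow> (bool \<times> 'x) list" where
  "word_comm u v = word_inv u @ word_inv v @ u @ v"

inductive nil2_cong :: "'x set \<Rightarrow> (bool \<times> 'x) list \<Rightarrow> (bool \<times> 'x) list \<Rightarrow> bool" for X where
  refl: "w \<in> word_set X \<Longrightarrow> nil2_cong X w w"
| sym: "nil2_cong X u v \<Longrightarrow> nil2_cong X v u"
| trans: "nil2_cong X u v \<Longrightarrow> nil2_cong X v w \<Longrightarrow> nil2_cong X u w"
| append: "nil2_cong X u u' \<Longrightarrow> nil2_cong X v v' \<Longrightarrow> nil2_cong X (u @ v) (u' @ v')"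
| inverse: "w \<in> word_set X \<Longrightarrow> nil2_cong X (word_inv w @ w) []"
| nil2: "u \<in> word_set X \<Longrightarrow> v \<in> word_set X \<Longrightarrow> w \<in> word_set X \<Longrightarrow>
    nil2_cong X (word_comm (word_comm u v) w) []"

definition word_class :: "'x set \<Rightarrow> (bool \<times> 'x) list \<Rightarrow> (bool \<times> 'x) list set" where
  "word_class X w = {v. nil2_cong X w v}"

definition free_nil2_group :: "'x set \<Rightarrow> (bool \<times> 'x) list set monoid" where
  "free_nil2_group X =
    \<lparr>carrier = word_class X ` word_set X,
     mult = (\<lambda>A B. \<Union>u\<in>A. \<Union>v\<in>B. word_class X (u @ v)),
     one = word_class X []\<rparr>"

text \<open>Taking the basis in the carrier type is no restriction, since the generators of a free
  nil2-group are distinct.\<close>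

definition free_nil2 :: "'a monoid \<Rightarrow> bool" where
  "free_nil2 F \<longleftrightarrow> group F \<and> (\<exists>X :: 'a set. F \<cong> free_nil2_group X)"


section \<open>Weakly quadratic maps, quadratic maps and q-maps\<close>

definition cross_effect ::
    "('a, 'm) monoid_scheme \<Rightarrow> ('b, 'n) monoid_scheme \<Rightarrow> ('a \<Rightarrow> 'b) \<Rightarrow> 'a \<Rightarrow> 'a \<Rightarrow> 'b" where
  "cross_effect G H f a b = inv\<^bsub>H\<^esub> (f a \<otimes>\<^bsub>H\<^esub> f b) \<otimes>\<^bsub>H\<^esub> f (a \<otimes>\<^bsub>G\<^esub> b)"

definition weakly_quadratic ::
    "('a, 'm) monoid_scheme \<Rightarrow> ('b, 'n) monoid_scheme \<Rightarrow> ('a \<Rightarrow> 'b) \<Rightarrow> bool" where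
  "weakly_quadratic G H f \<longleftrightarrow>
     f \<in> carrier G \<rightarrow> carrier H \<and>
     (\<forall>a\<in>carrier G. \<forall>b\<in>carrier G. \<forall>c\<in>carrier G.
        cross_effect G H f a b \<otimes>\<^bsub>H\<^esub> f c = f c \<otimes>\<^bsub>H\<^esub> cross_effect G H f a b \<and>
        cross_effect G H f (a \<otimes>\<^bsub>G\<^esub> b) c = cross_effect G H f a c \<otimes>\<^bsub>H\<^esub> cross_effect G H f b c \<and>
        cross_effect G H f a (b \<otimes>\<^bsub>G\<^esub> c) = cross_effect G H f a b \<otimes>\<^bsub>H\<^esub> cross_effect G H f a c)"

definition quadratic ::
    "('a, 'm) monoid_scheme \<Rightarrow> ('b, 'n) monoid_scheme \<Rightarrow> ('a \<Rightarrow> 'b) \<Rightarrow> bool" where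
  "quadratic G H f \<longleftrightarrow> weakly_quadratic G H f \<and>
     (\<forall>a\<in>carrier G. \<forall>b\<in>carrier G. \<forall>h\<in>carrier H.
        cross_effect G H f a b \<otimes>\<^bsub>H\<^esub> h = h \<otimes>\<^bsub>H\<^esub> cross_effect G H f a b)"

definition q_map :: "'a monoid \<Rightarrow> 'b monoid \<Rightarrow> ('a \<Rightarrow> 'b) \<Rightarrow> bool" where
  "q_map G H f \<longleftrightarrow> nil2_group G \<and> nil2_group H \<and> weakly_quadratic G H f \<and>
     (\<forall>a\<in>carrier G. \<forall>b\<in>carrier G. cross_effect G H f a b \<in> derived H (carrier H))"

text \<open>The group of quadratic maps. Its elements are extensional, so that equality of elements is
  equality of maps on the carrier.\<close>

definition Quad :: "'a monoid \<Rightarrow> 'b monoid \<Rightarrow> ('a \<Rightarrow> 'b) monoid" where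
  "Quad G H =
    \<lparr>carrier = {f \<in> carrier G \<rightarrow>\<^sub>E carrier H. quadratic G H f},
     mult = (\<lambda>f g. \<lambda>x\<in>carrier G. f x \<otimes>\<^bsub>H\<^esub> g x),
     one = (\<lambda>x\<in>carrier G. \<one>\<^bsub>H\<^esub>)\<rparr>"


section \<open>Simplicial groups and free resolutions\<close>

text \<open>\<open>face X n i\<close> is the face map \<open>d\<^sub>i\<close> from level \<open>n + 1\<close> to level \<open>n\<close> (for \<open>i \<le> n + 1\<close>), and
  \<open>degen X n i\<close> is the degeneracy \<open>s\<^sub>i\<close> from level \<open>n\<close> to level \<open>n + 1\<close> (for \<open>i \<le> n\<close>). All levels
  have carriers in one type; any sequence of groups can be arranged that way.\<close>

record 'a simplicial_data =
  level :: "nat \<Rightarrow> 'a monoid"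
  face :: "nat \<Rightarrow> nat \<Rightarrow> 'a \<Rightarrow> 'a"
  degen :: "nat \<Rightarrow> nat \<Rightarrow> 'a \<Rightarrow> 'a"

definition simplicial_nil2_group :: "'a simplicial_data \<Rightarrow> bool" where
  "simplicial_nil2_group X \<longleftrightarrow>
     (\<forall>n. nil2_group (level X n)) \<and>
     (\<forall>n. \<forall>i\<le>Suc n. face X n i \<in> hom (level X (Suc n)) (level X n)) \<and>
     (\<forall>n. \<forall>i\<le>n. degen X n i \<in> hom (level X n) (level X (Suc n))) \<and>
     (\<forall>n i j. \<forall>x\<in>carrier (level X (Suc (Suc n))). i < j \<and> j \<le> Suc (Suc n) \<longrightarrow>
        face X n i (face X (Suc n) j x) = face X n (j - 1) (face X (Suc n) i x)) \<and>
     (\<forall>n j. \<forall>x\<in>carrier (level X n). j \<le> n \<longrightarrow>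
        face X n j (degen X n j x) = x \<and> face X n (Suc j) (degen X n j x) = x) \<and>
     (\<forall>n i j. \<forall>x\<in>carrier (level X (Suc n)). i < j \<and> j \<le> Suc n \<longrightarrow>
        face X (Suc n) i (degen X (Suc n) j x) = degen X n (j - 1) (face X n i x)) \<and>
     (\<forall>n i j. \<forall>x\<in>carrier (level X (Suc n)). Suc j < i \<and> i \<le> Suc (Suc n) \<longrightarrow>
        face X (Suc n) i (degen X (Suc n) j x) = degen X n j (face X n (i - 1) x)) \<and>
     (\<forall>n i j. \<forall>x\<in>carrier (level X n). i \<le> j \<and> j \<le> n \<longrightarrow>
        degen X (Suc n) i (degen X n j x) = degen X (Suc n) (Suc j) (degen X n i x))"

text \<open>Homotopy groups are computed from the Moore complex: a normalized chain is killed by all faces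
  but the last one, and the last face is the boundary map.\<close>

fun moore_chains :: "'a simplicial_data \<Rightarrow> nat \<Rightarrow> 'a set" where
  "moore_chains X 0 = carrier (level X 0)"
| "moore_chains X (Suc n) =
     {x \<in> carrier (level X (Suc n)). \<forall>i\<le>n. face X n i x = \<one>\<^bsub>level X n\<^esub>}"

fun moore_cycles :: "'a simplicial_data \<Rightarrow> nat \<Rightarrow> 'a set" where
  "moore_cycles X 0 = moore_chains X 0"
| "moore_cycles X (Suc n) = {x \<in> moore_chains X (Suc n). face X n (Suc n) x = \<one>\<^bsub>level X n\<^esub>}"

definition moore_boundaries :: "'a simplicial_data \<Rightarrow> nat \<Rightarrow> 'a set" where
  "moore_boundaries X n = face X n (Suc n) ` moore_chains X (Suc n)"

definition homotopy_group :: "'a simplicial_data \<Rightarrow> nat \<Rightarrow> 'a set monoid" where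
  "homotopy_group X n = (level X n)\<lparr>carrier := moore_cycles X n\<rparr> Mod moore_boundaries X n"

text \<open>The identification of \<open>\<pi>\<^sub>0\<close> with \<open>G\<close> is an isomorphism \<open>\<theta>\<close>, part of the data of a resolution.\<close>

definition free_simplicial_resolution ::
    "'a simplicial_data \<Rightarrow> 'g monoid \<Rightarrow> ('a set \<Rightarrow> 'g) \<Rightarrow> bool" where
  "free_simplicial_resolution X G \<theta> \<longleftrightarrow>
     simplicial_nil2_group X \<and>
     (\<forall>n. free_nil2 (level X n)) \<and>
     (\<forall>i>0. carrier (homotopy_group X i) = {\<one>\<^bsub>homotopy_group X i\<^esub>}) \<and>
     \<theta> \<in> iso (homotopy_group X 0) G"

definition augmentation :: "'a simplicial_data \<Rightarrow> ('a set \<Rightarrow> 'g) \<Rightarrow> 'a \<Rightarrow> 'g" where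
  "augmentation X \<theta> x = \<theta> (moore_boundaries X 0 #>\<^bsub>level X 0\<^esub> x)"


section \<open>Derived functors of Quad\<close>

definition quad_coface ::
    "'a simplicial_data \<Rightarrow> nat \<Rightarrow> nat \<Rightarrow> ('a \<Rightarrow> 'b) \<Rightarrow> 'a \<Rightarrow> 'b" where
  "quad_coface X n j c = (\<lambda>x\<in>carrier (level X (Suc n)). c (face X n j x))"

definition quad_coboundary ::
    "'a simplicial_data \<Rightarrow> 'b monoid \<Rightarrow> nat \<Rightarrow> ('a \<Rightarrow> 'b) \<Rightarrow> 'a \<Rightarrow> 'b" where
  "quad_coboundary X A n c =
     finprod (Quad (level X (Suc n)) A)
       (\<lambda>j. quad_coface X n j c [^]\<^bsub>Quad (level X (Suc n)) A\<^esub> ((- 1) ^ j :: int)) {..Suc n}"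

definition quad_cocycles :: "'a simplicial_data \<Rightarrow> 'b monoid \<Rightarrow> nat \<Rightarrow> ('a \<Rightarrow> 'b) set" where
  "quad_cocycles X A n =
     {c \<in> carrier (Quad (level X n) A). quad_coboundary X A n c = \<one>\<^bsub>Quad (level X (Suc n)) A\<^esub>}"

fun quad_coboundaries :: "'a simplicial_data \<Rightarrow> 'b monoid \<Rightarrow> nat \<Rightarrow> ('a \<Rightarrow> 'b) set" where
  "quad_coboundaries X A 0 = {\<one>\<^bsub>Quad (level X 0) A\<^esub>}"
| "quad_coboundaries X A (Suc n) = quad_coboundary X A n ` carrier (Quad (level X n) A)"

definition quad_cohomology ::
    "'a simplicial_data \<Rightarrow> 'b monoid \<Rightarrow> nat \<Rightarrow> ('a \<Rightarrow> 'b) set monoid" where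
  "quad_cohomology X A n =
     (Quad (level X n) A)\<lparr>carrier := quad_cocycles X A n\<rparr> Mod quad_coboundaries X A n"

definition quad_class ::
    "'a simplicial_data \<Rightarrow> 'b monoid \<Rightarrow> nat \<Rightarrow> ('a \<Rightarrow> 'b) \<Rightarrow> ('a \<Rightarrow> 'b) set" where
  "quad_class X A n c = quad_coboundaries X A n #>\<^bsub>Quad (level X n) A\<^esub> c"

text \<open>Maps of resolutions over \<open>G\<close>. Compatibility with degeneracies is not demanded, because
  the comparison maps between degreewise free resolutions need only respect the faces; simplicial
  maps are a special case.\<close>

definition resolution_map ::
    "'b simplicial_data \<Rightarrow> ('b set \<Rightarrow> 'g) \<Rightarrow> 'a simplicial_data \<Rightarrow> ('a set \<Rightarrow> 'g) \<Rightarrow>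
      (nat \<Rightarrow> 'b \<Rightarrow> 'a) \<Rightarrow> bool" where
  "resolution_map Y \<eta> X \<theta> t \<longleftrightarrow>
     (\<forall>n. t n \<in> hom (level Y n) (level X n)) \<and>
     (\<forall>n. \<forall>j\<le>Suc n. \<forall>y\<in>carrier (level Y (Suc n)).
        face X n j (t (Suc n) y) = t n (face Y n j y)) \<and>
     (\<forall>y\<in>carrier (level Y 0). augmentation X \<theta> (t 0 y) = augmentation Y \<eta> y)"

text \<open>The induced map on cohomology, applied to a cohomology class \<open>K\<close>, i.e. a coset of cocycles.\<close>

definition quad_cohomology_map ::
    "'b simplicial_data \<Rightarrow> 'c monoid \<Rightarrow> nat \<Rightarrow> (nat \<Rightarrow> 'b \<Rightarrow> 'a) \<Rightarrow>
      ('a \<Rightarrow> 'c) set \<Rightarrow> ('b \<Rightarrow> 'c) set" where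
  "quad_cohomology_map Y A n t K =
     (\<Union>c\<in>K. quad_class Y A n (\<lambda>y\<in>carrier (level Y n). c (t n y)))"


section \<open>The connecting map\<close>

definition connecting_lift ::
    "'a simplicial_data \<Rightarrow> ('a set \<Rightarrow> 'g) \<Rightarrow> 'h monoid \<Rightarrow> ('g \<Rightarrow> 'h set) \<Rightarrow> ('a \<Rightarrow> 'h) \<Rightarrow> bool" where
  "connecting_lift X \<theta> H f \<phi> \<longleftrightarrow> q_map (level X 0) H \<phi> \<and>
     (\<forall>x\<in>carrier (level X 0). ab_proj H (\<phi> x) = f (augmentation X \<theta> x))"

definition connecting_cochain :: "'a simplicial_data \<Rightarrow> 'h monoid \<Rightarrow> ('a \<Rightarrow> 'h) \<Rightarrow> 'a \<Rightarrow> 'h" where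
  "connecting_cochain X H \<phi> =
     (\<lambda>x\<in>carrier (level X 1). inv\<^bsub>H\<^esub> \<phi> (face X 0 0 x) \<otimes>\<^bsub>H\<^esub> \<phi> (face X 0 1 x))"

definition obstruction ::
    "'a simplicial_data \<Rightarrow> ('a set \<Rightarrow> 'g) \<Rightarrow> 'h monoid \<Rightarrow> ('g \<Rightarrow> 'h set) \<Rightarrow> ('a \<Rightarrow> 'h) set" where
  "obstruction X \<theta> H f =
     (THE k. \<exists>\<phi>. connecting_lift X \<theta> H f \<phi> \<and>
        k = quad_class X (commutator_group H) 1 (connecting_cochain X H \<phi>))"


section \<open>The universal property of the free nil2-groups\<close>

lemma commutator_in_derived:
  assumes "group G" "a \<in> carrier G" "b \<in> carrier G"
  shows "commutator G a b \<in> derived G (carrier G)"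
proof -
  interpret group G by fact
  have "commutator G a b = inv\<^bsub>G\<^esub> a \<otimes>\<^bsub>G\<^esub> inv\<^bsub>G\<^esub> b \<otimes>\<^bsub>G\<^esub> inv\<^bsub>G\<^esub> (inv\<^bsub>G\<^esub> a) \<otimes>\<^bsub>G\<^esub> inv\<^bsub>G\<^esub> (inv\<^bsub>G\<^esub> b)"
    using assms by (simp add: commutator_def)
  then have "commutator G a b \<in> derived_set G (carrier G)"
    using assms by blast
  then show ?thesis
    unfolding derived_def by (rule generate.incl)
qed

lemma commutator_eq_one_iff:
  assumes "group G" "a \<in> carrier G" "b \<in> carrier G"
  shows "commutator G a b = \<one>\<^bsub>G\<^esub> \<longleftrightarrow> a \<otimes>\<^bsub>G\<^esub> b = b \<otimes>\<^bsub>G\<^esub> a"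
proof -
  interpret group G by fact
  have "commutator G a b = inv\<^bsub>G\<^esub> (b \<otimes>\<^bsub>G\<^esub> a) \<otimes>\<^bsub>G\<^esub> (a \<otimes>\<^bsub>G\<^esub> b)"
    using assms by (simp add: commutator_def inv_mult_group m_assoc)
  then have "commutator G a b = \<one>\<^bsub>G\<^esub> \<longleftrightarrow>
      inv\<^bsub>G\<^esub> (b \<otimes>\<^bsub>G\<^esub> a) \<otimes>\<^bsub>G\<^esub> (a \<otimes>\<^bsub>G\<^esub> b) = inv\<^bsub>G\<^esub> (b \<otimes>\<^bsub>G\<^esub> a) \<otimes>\<^bsub>G\<^esub> (b \<otimes>\<^bsub>G\<^esub> a)"
    using assms by (simp only: l_inv m_closed)
  also have "\<dots> \<longleftrightarrow> a \<otimes>\<^bsub>G\<^esub> b = b \<otimes>\<^bsub>G\<^esub> a"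
    using assms by (intro Units_l_cancel) simp_all
  finally show ?thesis .
qed

lemma nil2_group_commutes:
  assumes "nil2_group G" "a \<in> derived G (carrier G)" "b \<in> carrier G"
  shows "a \<otimes>\<^bsub>G\<^esub> b = b \<otimes>\<^bsub>G\<^esub> a"
proof -
  interpret group G using assms(1) by (simp add: nil2_group_def)
  have a: "a \<in> carrier G"
    using assms(2) derived_in_carrier[of "carrier G"] by blast
  have "commutator G a b \<in>
      generate G {commutator G a b | a b. a \<in> derived G (carrier G) \<and> b \<in> carrier G}"
    using assms(2,3) by (intro generate.incl) blast
  then have "commutator G a b = \<one>\<^bsub>G\<^esub>"
    using assms(1) by (simp add: nil2_group_def)
  then show ?thesis
    using commutator_eq_one_iff[OF group_axioms a assms(3)] by simp
qed

lemma nil2_groupI: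
  assumes "group G"
    and comm: "\<And>a b c. a \<in> carrier G \<Longrightarrow> b \<in> carrier G \<Longrightarrow> c \<in> carrier G \<Longrightarrow>
      commutator G (commutator G a b) c = \<one>\<^bsub>G\<^esub>"
  shows "nil2_group G"
proof -
  interpret group G by fact
  define Z where "Z = {a \<in> carrier G. \<forall>b\<in>carrier G. a \<otimes>\<^bsub>G\<^esub> b = b \<otimes>\<^bsub>G\<^esub> a}"
  have Z: "subgroup Z G"
  proof (rule subgroupI)
    show "Z \<subseteq> carrier G" by (auto simp: Z_def)
    show "Z \<noteq> {}" by (auto simp: Z_def intro!: exI[of _ "\<one>\<^bsub>G\<^esub>"])
  next
    fix a assume a: "a \<in> Z"
    have "inv\<^bsub>G\<^esub> a \<otimes>\<^bsub>G\<^esub> b = b \<otimes>\<^bsub>G\<^esub> inv\<^bsub>G\<^esub> a" if b: "b \<in> carrier G" for b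
    proof -
      have "a \<otimes>\<^bsub>G\<^esub> inv\<^bsub>G\<^esub> b = inv\<^bsub>G\<^esub> b \<otimes>\<^bsub>G\<^esub> a" "a \<in> carrier G"
        using a b by (auto simp: Z_def)
      then have "inv\<^bsub>G\<^esub> (a \<otimes>\<^bsub>G\<^esub> inv\<^bsub>G\<^esub> b) = inv\<^bsub>G\<^esub> (inv\<^bsub>G\<^esub> b \<otimes>\<^bsub>G\<^esub> a)" by simp
      then show ?thesis
        using b \<open>a \<in> carrier G\<close> by (simp add: inv_mult_group)
    qed
    then show "inv\<^bsub>G\<^esub> a \<in> Z" using a by (auto simp: Z_def)
  next
    fix a b assume ab: "a \<in> Z" "b \<in> Z"
    have "a \<otimes>\<^bsub>G\<^esub> b \<otimes>\<^bsub>G\<^esub> c = c \<otimes>\<^bsub>G\<^esub> (a \<otimes>\<^bsub>G\<^esub> b)" if c: "c \<in> carrier G" for c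
    proof -
      have "a \<in> carrier G" "b \<in> carrier G" "a \<otimes>\<^bsub>G\<^esub> c = c \<otimes>\<^bsub>G\<^esub> a" "b \<otimes>\<^bsub>G\<^esub> c = c \<otimes>\<^bsub>G\<^esub> b"
        using ab c by (auto simp: Z_def)
      then show ?thesis using c by (metis m_assoc)
    qed
    moreover have "a \<otimes>\<^bsub>G\<^esub> b \<in> carrier G" using ab unfolding Z_def by blast
    ultimately show "a \<otimes>\<^bsub>G\<^esub> b \<in> Z" unfolding Z_def mem_Collect_eq by (intro conjI ballI)
  qed
  have "derived_set G (carrier G) \<subseteq> Z"
  proof
    fix z assume "z \<in> derived_set G (carrier G)"
    then obtain a b where ab: "a \<in> carrier G" "b \<in> carrier G"
      and z: "z = a \<otimes>\<^bsub>G\<^esub> b \<otimes>\<^bsub>G\<^esub> inv\<^bsub>G\<^esub> a \<otimes>\<^bsub>G\<^esub> inv\<^bsub>G\<^esub> b" by fast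
    have "a \<otimes>\<^bsub>G\<^esub> b \<otimes>\<^bsub>G\<^esub> inv\<^bsub>G\<^esub> a \<otimes>\<^bsub>G\<^esub> inv\<^bsub>G\<^esub> b = commutator G (inv\<^bsub>G\<^esub> a) (inv\<^bsub>G\<^esub> b)"
      using ab by (simp add: commutator_def)
    moreover have *: "commutator G (inv\<^bsub>G\<^esub> a) (inv\<^bsub>G\<^esub> b) \<in> carrier G"
      using ab by (simp add: commutator_def)
    moreover have "commutator G (inv\<^bsub>G\<^esub> a) (inv\<^bsub>G\<^esub> b) \<otimes>\<^bsub>G\<^esub> c =
        c \<otimes>\<^bsub>G\<^esub> commutator G (inv\<^bsub>G\<^esub> a) (inv\<^bsub>G\<^esub> b)" if "c \<in> carrier G" for c
      using comm[of "inv\<^bsub>G\<^esub> a" "inv\<^bsub>G\<^esub> b" c] ab that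
        commutator_eq_one_iff[OF group_axioms * that] by simp
    ultimately show "z \<in> Z" by (simp add: Z_def z)
  qed
  then have derived: "derived G (carrier G) \<subseteq> Z"
    unfolding derived_def by (rule generate_subgroup_incl[OF _ Z])
  have "{commutator G a b | a b. a \<in> derived G (carrier G) \<and> b \<in> carrier G} \<subseteq> {\<one>\<^bsub>G\<^esub>}"
  proof clarify
    fix a b assume "a \<in> derived G (carrier G)" and b: "b \<in> carrier G"
    then have "a \<in> Z" using derived by blast
    then show "commutator G a b = \<one>\<^bsub>G\<^esub>"
      using b commutator_eq_one_iff[OF group_axioms, of a b] unfolding Z_def by blast
  qed
  from generate_subgroup_incl[OF this triv_subgroup]
  have "generate G {commutator G a b | a b. a \<in> derived G (carrier G) \<and> b \<in> carrier G} = {\<one>\<^bsub>G\<^esub>}"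
    using generate.one by blast
  then show ?thesis
    using group_axioms by (simp add: nil2_group_def)
qed

lemma word_set_simps [simp]:
  "[] \<in> word_set X"
  "l # w \<in> word_set X \<longleftrightarrow> snd l \<in> X \<and> w \<in> word_set X"
  "u @ v \<in> word_set X \<longleftrightarrow> u \<in> word_set X \<and> v \<in> word_set X"
  by (cases l; auto simp: word_set_def)+

lemma word_inv_simps [simp]:
  "word_inv [] = []"
  "word_inv (l # w) = word_inv w @ [(\<not> fst l, snd l)]"
  by (simp_all add: word_inv_def case_prod_beta)

lemma word_inv_in_word_set [simp]: "word_inv w \<in> word_set X \<longleftrightarrow> w \<in> word_set X"
  by (induction w) auto

lemma word_inv_word_inv [simp]: "word_inv (word_inv w) = w"
  by (simp add: word_inv_def rev_map case_prod_beta comp_def)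

lemma word_comm_in_word_set [simp]:
  "u \<in> word_set X \<Longrightarrow> v \<in> word_set X \<Longrightarrow> word_comm u v \<in> word_set X"
  by (simp add: word_comm_def)

lemma nil2_cong_word_set: "nil2_cong X u v \<Longrightarrow> u \<in> word_set X \<and> v \<in> word_set X"
  by (induction rule: nil2_cong.induct) auto

lemma word_class_eq_iff:
  assumes "u \<in> word_set X"
  shows "word_class X u = word_class X v \<longleftrightarrow> nil2_cong X u v"
  using assms by (auto simp: word_class_def intro: nil2_cong.intros)

lemma free_nil2_group_mult [simp]:
  assumes "u \<in> word_set X" "v \<in> word_set X"
  shows "word_class X u \<otimes>\<^bsub>free_nil2_group X\<^esub> word_class X v = word_class X (u @ v)"
proof -
  have "word_class X (u' @ v') = word_class X (u @ v)"
    if "u' \<in> word_class X u" "v' \<in> word_class X v" for u' v'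
    using that assms word_class_eq_iff[of "u @ v" X "u' @ v'"]
    by (auto simp: word_class_def intro: nil2_cong.append)
  moreover have "u \<in> word_class X u" "v \<in> word_class X v"
    using assms by (auto simp: word_class_def intro: nil2_cong.refl)
  ultimately have "(\<Union>u'\<in>word_class X u. \<Union>v'\<in>word_class X v. word_class X (u' @ v')) =
      word_class X (u @ v)"
    by blast
  then show ?thesis
    by (simp add: free_nil2_group_def)
qed

lemma group_free_nil2_group: "group (free_nil2_group X)"
proof (rule groupI)
  fix A B C
  assume A: "A \<in> carrier (free_nil2_group X)"
  obtain u where u: "u \<in> word_set X" "A = word_class X u"
    using A by (auto simp: free_nil2_group_def)
  have one: "\<one>\<^bsub>free_nil2_group X\<^esub> = word_class X []"
    by (simp add: free_nil2_group_def)
  show "\<one>\<^bsub>free_nil2_group X\<^esub> \<otimes>\<^bsub>free_nil2_group X\<^esub> A = A"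
    using u by (simp add: one)
  have "word_class X (word_inv u) \<otimes>\<^bsub>free_nil2_group X\<^esub> A = \<one>\<^bsub>free_nil2_group X\<^esub>"
    using u by (simp add: one word_class_eq_iff nil2_cong.inverse)
  then show "\<exists>y\<in>carrier (free_nil2_group X). y \<otimes>\<^bsub>free_nil2_group X\<^esub> A = \<one>\<^bsub>free_nil2_group X\<^esub>"
    by (rule bexI) (use u in \<open>simp add: free_nil2_group_def\<close>)
  assume B: "B \<in> carrier (free_nil2_group X)"
  obtain v where v: "v \<in> word_set X" "B = word_class X v"
    using B by (auto simp: free_nil2_group_def)
  have "word_class X (u @ v) \<in> carrier (free_nil2_group X)"
    using u v by (simp add: free_nil2_group_def)
  then show "A \<otimes>\<^bsub>free_nil2_group X\<^esub> B \<in> carrier (free_nil2_group X)"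
    using u v by simp
  assume C: "C \<in> carrier (free_nil2_group X)"
  obtain w where "w \<in> word_set X" "C = word_class X w"
    using C by (auto simp: free_nil2_group_def)
  then show "A \<otimes>\<^bsub>free_nil2_group X\<^esub> B \<otimes>\<^bsub>free_nil2_group X\<^esub> C =
      A \<otimes>\<^bsub>free_nil2_group X\<^esub> (B \<otimes>\<^bsub>free_nil2_group X\<^esub> C)"
    using u v by simp
qed (auto simp: free_nil2_group_def)

lemma free_nil2_group_inv:
  assumes "w \<in> word_set X"
  shows "inv\<^bsub>free_nil2_group X\<^esub> (word_class X w) = word_class X (word_inv w)"
proof -
  interpret group "free_nil2_group X" by (rule group_free_nil2_group)
  show ?thesis
  proof (rule inv_equality)
    have "nil2_cong X (word_inv w @ w) []"
      using assms by (rule nil2_cong.inverse)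
    then show "word_class X (word_inv w) \<otimes>\<^bsub>free_nil2_group X\<^esub> word_class X w =
        \<one>\<^bsub>free_nil2_group X\<^esub>"
      using assms word_class_eq_iff[of "word_inv w @ w" X "[]"]
      by simp (simp add: free_nil2_group_def)
  qed (use assms in \<open>auto simp: free_nil2_group_def\<close>)
qed

lemma nil2_group_free_nil2_group: "nil2_group (free_nil2_group X)"
proof (rule nil2_groupI[OF group_free_nil2_group])
  fix A B C
  assume "A \<in> carrier (free_nil2_group X)" "B \<in> carrier (free_nil2_group X)"
    "C \<in> carrier (free_nil2_group X)"
  then obtain u v w where uvw: "u \<in> word_set X" "A = word_class X u"
    "v \<in> word_set X" "B = word_class X v" "w \<in> word_set X" "C = word_class X w"
    by (auto simp: free_nil2_group_def)
  have comm: "commutator (free_nil2_group X) (word_class X u) (word_class X v) =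
      word_class X (word_comm u v)" if "u \<in> word_set X" "v \<in> word_set X" for u v
    using that by (simp add: commutator_def free_nil2_group_inv word_comm_def)
  have "nil2_cong X (word_comm (word_comm u v) w) []"
    using uvw by (intro nil2_cong.nil2)
  then have "word_class X (word_comm (word_comm u v) w) = word_class X []"
    using uvw by (simp add: word_class_eq_iff)
  then show "commutator (free_nil2_group X) (commutator (free_nil2_group X) A B) C =
      \<one>\<^bsub>free_nil2_group X\<^esub>"
    using uvw by (simp add: comm) (simp add: free_nil2_group_def)
qed

primrec word_eval :: "('k, 'm) monoid_scheme \<Rightarrow> ('x \<Rightarrow> 'k) \<Rightarrow> (bool \<times> 'x) list \<Rightarrow> 'k" where
  "word_eval K g [] = \<one>\<^bsub>K\<^esub>"
| "word_eval K g (l # w) =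
     (if fst l then g (snd l) else inv\<^bsub>K\<^esub> g (snd l)) \<otimes>\<^bsub>K\<^esub> word_eval K g w"

theorem free_nil2_group_universal:
  fixes K :: "('k, 'm) monoid_scheme" and X :: "'x set"
  assumes K: "nil2_group K" and g: "g \<in> X \<rightarrow> carrier K"
  shows "\<exists>h. h \<in> hom (free_nil2_group X) K \<and> (\<forall>x\<in>X. h (word_class X [(True, x)]) = g x) \<and>
    (\<forall>h'\<in>hom (free_nil2_group X) K. (\<forall>x\<in>X. h' (word_class X [(True, x)]) = g x) \<longrightarrow>
      (\<forall>A\<in>carrier (free_nil2_group X). h' A = h A))"
proof -
  interpret group K using K by (simp add: nil2_group_def)
  let ?e = "word_eval K g"
  have closed: "?e w \<in> carrier K" if "w \<in> word_set X" for w
    using that g by (induction w) auto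
  have app: "?e (u @ v) = ?e u \<otimes>\<^bsub>K\<^esub> ?e v" if "u \<in> word_set X" "v \<in> word_set X" for u v
    using that closed g by (induction u) (auto simp: m_assoc Pi_iff)
  have inv: "?e (word_inv w) = inv\<^bsub>K\<^esub> ?e w" if "w \<in> word_set X" for w
    using that
  proof (induction w)
    case (Cons l w)
    then have "g (snd l) \<in> carrier K" "w \<in> word_set X" using g by auto
    with Cons show ?case
      using closed[of w] app[of "word_inv w" "[(\<not> fst l, snd l)]"] by (simp add: inv_mult_group)
  qed simp
  have comm: "?e (word_comm u v) = commutator K (?e u) (?e v)"
    if "u \<in> word_set X" "v \<in> word_set X" for u v
    using that closed by (simp add: word_comm_def app inv commutator_def m_assoc)
  have cong: "?e u = ?e v" if "nil2_cong X u v" for u v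
    using that
  proof (induction rule: nil2_cong.induct)
    case (append u u' v v')
    then show ?case by (auto dest!: nil2_cong_word_set simp: app)
  next
    case (inverse w)
    then show ?case by (simp add: app inv closed)
  next
    case (nil2 u v w)
    then have "commutator K (?e u) (?e v) \<in> derived K (carrier K)"
      using commutator_in_derived[OF group_axioms] closed by blast
    moreover from this have "commutator K (?e u) (?e v) \<in> carrier K"
      using derived_in_carrier[of "carrier K"] by blast
    ultimately show ?case
      using nil2 nil2_group_commutes[OF K] commutator_eq_one_iff[OF group_axioms]
      by (simp add: comm closed)
  qed auto
  define h where "h A = ?e (SOME w. w \<in> A)" for A
  have h: "h (word_class X w) = ?e w" if "w \<in> word_set X" for w
  proof -
    have "w \<in> word_class X w"
      using that by (simp add: word_class_def nil2_cong.refl)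
    then have "(SOME v. v \<in> word_class X w) \<in> word_class X w" by (rule someI)
    then show ?thesis using cong by (auto simp: word_class_def h_def)
  qed
  have hom: "h \<in> hom (free_nil2_group X) K"
  proof (rule homI)
    fix A B assume AB: "A \<in> carrier (free_nil2_group X)" "B \<in> carrier (free_nil2_group X)"
    then obtain u v where "u \<in> word_set X" "A = word_class X u" "v \<in> word_set X" "B = word_class X v"
      by (auto simp: free_nil2_group_def)
    then show "h (A \<otimes>\<^bsub>free_nil2_group X\<^esub> B) = h A \<otimes>\<^bsub>K\<^esub> h B"
      by (simp add: h app)
  qed (auto simp: free_nil2_group_def h closed)
  have "h' A = h A" if h': "h' \<in> hom (free_nil2_group X) K"
    "\<forall>x\<in>X. h' (word_class X [(True, x)]) = g x" and A: "A \<in> carrier (free_nil2_group X)" for h' A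
  proof -
    interpret h': group_hom "free_nil2_group X" K h'
      using h'(1) by (simp add: group_hom_def group_hom_axioms_def group_free_nil2_group group_axioms)
    have "h' (word_class X w) = ?e w" if "w \<in> word_set X" for w
      using that
    proof (induction w)
      case Nil
      then show ?case using h'.hom_one by (simp add: free_nil2_group_def)
    next
      case (Cons l w)
      then have l: "snd l \<in> X" and w: "w \<in> word_set X" by auto
      have "word_class X [(True, snd l)] \<in> carrier (free_nil2_group X)"
        using l by (simp add: free_nil2_group_def)
      then have "h' (word_class X [(False, snd l)]) = inv\<^bsub>K\<^esub> g (snd l)"
        using h'.hom_inv[of "word_class X [(True, snd l)]"] h'(2) l
        by (simp add: free_nil2_group_inv)
      then have "h' (word_class X [l]) = (if fst l then g (snd l) else inv\<^bsub>K\<^esub> g (snd l))"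
        using h'(2) l by (cases l) auto
      moreover have "word_class X (l # w) =
          word_class X [l] \<otimes>\<^bsub>free_nil2_group X\<^esub> word_class X w"
        using l w by simp
      moreover have "word_class X [l] \<in> carrier (free_nil2_group X)"
        "word_class X w \<in> carrier (free_nil2_group X)"
        using l w by (auto simp: free_nil2_group_def)
      ultimately show ?case using Cons.IH[OF w] by simp
    qed
    then show ?thesis using A by (auto simp: free_nil2_group_def h)
  qed
  moreover have "h (word_class X [(True, x)]) = g x" if "x \<in> X" for x
    using that funcset_mem[OF g that] by (simp add: h)
  ultimately show ?thesis using hom by blast
qed

end

theory Submission
  imports Defs
begin

text \<open>The cochain of a lift \<open>\<phi>\<close> is \<open>\<phi>(d\<^sub>0 x)\<^sup>-\<^sup>1 \<phi>(d\<^sub>1 x)\<close>. Two lifts differ by a quadratic map into the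
  central subgroup \<open>[H, H]\<close>, and multiplying \<open>\<phi>\<close> by such a map changes its cochain by a coboundary.
  Hence the coset of the cochain of one lift is exactly the set of the cochains of all lifts. This
  description makes the obstruction visibly independent of choices and natural, and shows that it
  vanishes iff some lift \<open>\<phi>\<close> has \<open>\<phi> d\<^sub>0 = \<phi> d\<^sub>1\<close>. As \<open>G\<close> is the coequalizer of \<open>d\<^sub>0\<close> and \<open>d\<^sub>1\<close>, already on
  underlying sets, these lifts are those that factor through \<open>G\<close>.\<close>

section \<open>Commutator calculus and q-maps\<close>

lemma (in group) l_cancel_inv [simp]:
  assumes "x \<in> carrier G" "y \<in> carrier G"
  shows "x \<otimes> (inv x \<otimes> y) = y" "inv x \<otimes> (x \<otimes> y) = y"
  using assms by (simp_all add: m_assoc[symmetric])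

lemma (in group) abelian_nil2_group:
  assumes "\<And>a b. a \<in> carrier G \<Longrightarrow> b \<in> carrier G \<Longrightarrow> a \<otimes> b = b \<otimes> a"
  shows "nil2_group G"
proof (rule nil2_groupI[OF group_axioms])
  fix a b c assume "a \<in> carrier G" "b \<in> carrier G" "c \<in> carrier G"
  moreover from this have "commutator G a b = \<one>"
    using assms commutator_eq_one_iff[OF group_axioms] by blast
  ultimately show "commutator G (commutator G a b) c = \<one>"
    using assms commutator_eq_one_iff[OF group_axioms, of \<one> c] by simp
qed

section \<open>Bilinearity of commutators in nilpotency class two\<close>

locale nil2 = group H for H :: "'h monoid" (structure) +
  assumes nil2: "nil2_group H"
begin

abbreviation D :: "'h set" where "D \<equiv> derived H (carrier H)"

lemma D_normal: "D \<lhd> H"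
  by (rule derived_self_is_normal)

lemma D_subgroup: "subgroup D H"
  using D_normal by (rule normal_imp_subgroup)

lemma D_carrier [simp]: "a \<in> D \<Longrightarrow> a \<in> carrier H"
  using subgroup.subset[OF D_subgroup] by blast

lemma D_mult [simp]: "a \<in> D \<Longrightarrow> b \<in> D \<Longrightarrow> a \<otimes> b \<in> D"
  using D_subgroup by (rule subgroup.m_closed)

lemma D_inv [simp]: "a \<in> D \<Longrightarrow> inv a \<in> D"
  using D_subgroup by (rule subgroup.m_inv_closed)

lemma D_one [simp]: "\<one> \<in> D"
  using D_subgroup by (rule subgroup.one_closed)

lemma D_central: "a \<in> D \<Longrightarrow> b \<in> carrier H \<Longrightarrow> a \<otimes> b = b \<otimes> a"
  using nil2 by (rule nil2_group_commutes)

lemma commutator_D [simp]: "a \<in> carrier H \<Longrightarrow> b \<in> carrier H \<Longrightarrow> commutator H a b \<in> D"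
  using group_axioms by (rule commutator_in_derived)

lemma mult_commute_commutator:
  assumes "a \<in> carrier H" "b \<in> carrier H"
  shows "a \<otimes> b = b \<otimes> a \<otimes> commutator H a b"
  using assms by (simp add: commutator_def m_assoc)

lemma commutator_eqI:
  assumes "a \<in> carrier H" "b \<in> carrier H" "d \<in> D" "a \<otimes> b = b \<otimes> a \<otimes> d"
  shows "commutator H a b = d"
  using assms mult_commute_commutator[of a b]
  by (simp add: Units_l_cancel)

text \<open>Moving \<open>b\<close> to the left past \<open>a'\<close> and then past
  \<open>a\<close> leaves one commutator each time. Both are central, so they can be collected on
  the right.\<close>

lemma commutator_mult_left:
  assumes [simp]: "a \<in> carrier H" "a' \<in> carrier H" "b \<in> carrier H"
  shows "commutator H (a \<otimes> a') b = commutator H a b \<otimes> commutator H a' b"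
proof (rule commutator_eqI)
  have "a \<otimes> a' \<otimes> b = a \<otimes> b \<otimes> a' \<otimes> commutator H a' b"
    using mult_commute_commutator[of a' b] by (simp add: m_assoc)
  also have "\<dots> = b \<otimes> a \<otimes> (commutator H a b \<otimes> a') \<otimes> commutator H a' b"
    using mult_commute_commutator[of a b] by (simp add: m_assoc)
  also have "\<dots> = b \<otimes> (a \<otimes> a') \<otimes> (commutator H a b \<otimes> commutator H a' b)"
    using D_central[of "commutator H a b" a'] by (simp add: m_assoc)
  finally show "a \<otimes> a' \<otimes> b = b \<otimes> (a \<otimes> a') \<otimes> (commutator H a b \<otimes> commutator H a' b)" .
qed simp_all

lemma commutator_swap:
  assumes [simp]: "a \<in> carrier H" "b \<in> carrier H"
  shows "commutator H b a = inv (commutator H a b)"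
  by (simp add: commutator_def inv_mult_group m_assoc)

lemma commutator_mult_right:
  assumes [simp]: "a \<in> carrier H" "a' \<in> carrier H" "b \<in> carrier H"
  shows "commutator H b (a \<otimes> a') = commutator H b a \<otimes> commutator H b a'"
  using D_central[of "inv (commutator H a b)" "inv (commutator H a' b)"]
  by (simp add: commutator_swap[of _ b] commutator_mult_left inv_mult_group)

lemma commutator_central:
  assumes "a \<in> D" "b \<in> carrier H"
  shows "commutator H a b = \<one>" "commutator H b a = \<one>"
  using assms D_central[OF assms] by (simp_all add: commutator_eq_one_iff[OF group_axioms])

text \<open>The displayed equation forces \<open>\<beta>\<close> to be the cross effect of
  \<open>f\<close>, and the commutation clause of \<open>weakly_quadratic\<close> is automatic
  because \<open>D\<close> is central. Hence exhibiting a biadditive \<open>D\<close>-valued defect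
  suffices.\<close>

lemma q_mapI:
  assumes "nil2_group G" "f \<in> carrier G \<rightarrow> carrier H"
    and \<beta>: "\<And>a b. a \<in> carrier G \<Longrightarrow> b \<in> carrier G \<Longrightarrow> \<beta> a b \<in> D"
    and f: "\<And>a b. a \<in> carrier G \<Longrightarrow> b \<in> carrier G \<Longrightarrow> f (a \<otimes>\<^bsub>G\<^esub> b) = f a \<otimes> f b \<otimes> \<beta> a b"
    and "\<And>a b c. a \<in> carrier G \<Longrightarrow> b \<in> carrier G \<Longrightarrow> c \<in> carrier G \<Longrightarrow>
      \<beta> (a \<otimes>\<^bsub>G\<^esub> b) c = \<beta> a c \<otimes> \<beta> b c"
    and "\<And>a b c. a \<in> carrier G \<Longrightarrow> b \<in> carrier G \<Longrightarrow> c \<in> carrier G \<Longrightarrow>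
      \<beta> a (b \<otimes>\<^bsub>G\<^esub> c) = \<beta> a b \<otimes> \<beta> a c"
  shows "q_map G H f"
proof -
  interpret G: group G using assms(1) by (simp add: nil2_group_def)
  have fc: "\<And>a. a \<in> carrier G \<Longrightarrow> f a \<in> carrier H" using assms(2) by blast
  have ce: "cross_effect G H f a b = \<beta> a b" if "a \<in> carrier G" "b \<in> carrier G" for a b
    using that D_carrier[OF \<beta>[OF that]] by (simp add: cross_effect_def f fc inv_mult_group m_assoc)
  show ?thesis
    using assms nil2 by (simp add: q_map_def weakly_quadratic_def ce D_central fc)
qed

section \<open>Cross effects of a q-map\<close>

context
  fixes G :: "'g monoid" and f
  assumes f: "q_map G H f"
begin

lemma q_map_dom: "nil2_group G"
  using f by (simp add: q_map_def)

lemma q_map_closed: "a \<in> carrier G \<Longrightarrow> f a \<in> carrier H"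
  using f by (auto simp: q_map_def weakly_quadratic_def)

lemma q_map_cross:
  assumes "a \<in> carrier G" "b \<in> carrier G"
  shows "cross_effect G H f a b \<in> D" "f (a \<otimes>\<^bsub>G\<^esub> b) = f a \<otimes> f b \<otimes> cross_effect G H f a b"
proof -
  interpret G: group G using f by (simp add: q_map_def nil2_group_def)
  show "cross_effect G H f a b \<in> D" using f assms by (simp add: q_map_def)
  show "f (a \<otimes>\<^bsub>G\<^esub> b) = f a \<otimes> f b \<otimes> cross_effect G H f a b"
    using assms q_map_closed by (simp add: cross_effect_def m_assoc inv_mult_group)
qed

lemma q_map_cross_mult:
  assumes "a \<in> carrier G" "b \<in> carrier G" "c \<in> carrier G"
  shows "cross_effect G H f (a \<otimes>\<^bsub>G\<^esub> b) c = cross_effect G H f a c \<otimes> cross_effect G H f b c"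
    "cross_effect G H f a (b \<otimes>\<^bsub>G\<^esub> c) = cross_effect G H f a b \<otimes> cross_effect G H f a c"
  using f assms by (simp_all add: q_map_def weakly_quadratic_def)

text \<open>The cross effect is central, so commutators do not see it. This makes the commutator
  terms in the cross effects of products and inverses biadditive.\<close>

lemma q_map_commutator:
  assumes "a \<in> carrier G" "b \<in> carrier G" "h \<in> carrier H"
  shows "commutator H (f (a \<otimes>\<^bsub>G\<^esub> b)) h = commutator H (f a) h \<otimes> commutator H (f b) h"
    "commutator H h (f (a \<otimes>\<^bsub>G\<^esub> b)) = commutator H h (f a) \<otimes> commutator H h (f b)"
  using assms q_map_cross[of a b] q_map_closed
  by (simp_all add: commutator_mult_left commutator_mult_right commutator_central)

end

section \<open>Closure of q-maps under pointwise operations and precomposition\<close>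

lemma D_commute: "a \<in> D \<Longrightarrow> b \<in> D \<Longrightarrow> a \<otimes> b = b \<otimes> a"
  by (simp add: D_central)

lemma D_left_commute: "a \<in> D \<Longrightarrow> b \<in> D \<Longrightarrow> c \<in> D \<Longrightarrow> a \<otimes> (b \<otimes> c) = b \<otimes> (a \<otimes> c)"
  using D_central[of a b] by (simp add: m_assoc[symmetric])

lemma q_map_mult:
  assumes f: "q_map G H f" and g: "q_map G H g"
  shows "q_map G H (\<lambda>x. f x \<otimes> g x)"
proof -
  note [simp] = q_map_closed[OF f] q_map_closed[OF g] q_map_cross(1)[OF f] q_map_cross(1)[OF g]
  interpret G: group G using f by (simp add: q_map_def nil2_group_def)
  let ?\<beta> = "cross_effect G H f" and ?\<gamma> = "cross_effect G H g"
  show ?thesis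
  \<comment> \<open>The cross effects of \<open>f\<close> and \<open>g\<close> are central and just
    multiply. The commutator arises when \<open>f b\<close> is moved past \<open>g a\<close> to
    regroup the product.\<close>
  proof (rule q_mapI[where \<beta> = "\<lambda>a b. ?\<beta> a b \<otimes> ?\<gamma> a b \<otimes> commutator H (f b) (g a)"])
    fix a b assume [simp]: "a \<in> carrier G" "b \<in> carrier G"
    have "f (a \<otimes>\<^bsub>G\<^esub> b) \<otimes> g (a \<otimes>\<^bsub>G\<^esub> b) = f a \<otimes> f b \<otimes> (?\<beta> a b \<otimes> (g a \<otimes> g b)) \<otimes> ?\<gamma> a b"
      by (simp add: q_map_cross[OF f] q_map_cross[OF g] m_assoc)
    also have "\<dots> = f a \<otimes> (f b \<otimes> g a) \<otimes> g b \<otimes> (?\<beta> a b \<otimes> ?\<gamma> a b)"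
      using D_central[of "?\<beta> a b" "g a \<otimes> g b"] by (simp add: m_assoc)
    also have "\<dots> = f a \<otimes> g a \<otimes> f b \<otimes> (commutator H (f b) (g a) \<otimes> (g b \<otimes> (?\<beta> a b \<otimes> ?\<gamma> a b)))"
      using mult_commute_commutator[of "f b" "g a"] by (simp add: m_assoc)
    also have "\<dots> = f a \<otimes> g a \<otimes> (f b \<otimes> g b) \<otimes> (?\<beta> a b \<otimes> ?\<gamma> a b \<otimes> commutator H (f b) (g a))"
      using D_central[of "commutator H (f b) (g a)" "g b \<otimes> (?\<beta> a b \<otimes> ?\<gamma> a b)"]
      by (simp add: m_assoc)
    finally show "f (a \<otimes>\<^bsub>G\<^esub> b) \<otimes> g (a \<otimes>\<^bsub>G\<^esub> b) =
      f a \<otimes> g a \<otimes> (f b \<otimes> g b) \<otimes> (?\<beta> a b \<otimes> ?\<gamma> a b \<otimes> commutator H (f b) (g a))" .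
  qed (use q_map_dom[OF f] in \<open>simp_all add: q_map_cross_mult[OF f] q_map_cross_mult[OF g]
      q_map_commutator[OF f] q_map_commutator[OF g] m_assoc D_commute D_left_commute\<close>)
qed

lemma commutator_inv:
  assumes [simp]: "a \<in> carrier H" "b \<in> carrier H"
  shows "commutator H (inv a) b = inv (commutator H a b)"
    "commutator H a (inv b) = inv (commutator H a b)"
proof -
  have *: "commutator H (inv a) b = inv (commutator H a b)" if [simp]: "a \<in> carrier H" "b \<in> carrier H" for a b
    using commutator_mult_left[of "inv a" a b] commutator_central(1)[of \<one> b]
    by (intro inv_equality[symmetric]) simp_all
  show "commutator H (inv a) b = inv (commutator H a b)" by (simp add: *)
  show "commutator H a (inv b) = inv (commutator H a b)"
    using *[of b a] commutator_swap[of a b] commutator_swap[of "inv b" a] by simp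
qed

lemma q_map_inverse:
  assumes f: "q_map G H f"
  shows "q_map G H (\<lambda>x. inv (f x))"
proof -
  note [simp] = q_map_closed[OF f] q_map_cross(1)[OF f]
  interpret G: group G using f by (simp add: q_map_def nil2_group_def)
  let ?\<beta> = "cross_effect G H f"
  show ?thesis
  \<comment> \<open>Inversion reverses the product \<open>f a \<otimes> f b\<close>. Restoring the
    order costs the commutator of \<open>inv (f b)\<close> and \<open>inv (f a)\<close>, in which
    the two inversions cancel by bilinearity.\<close>
  proof (rule q_mapI[where \<beta> = "\<lambda>a b. inv (?\<beta> a b) \<otimes> commutator H (f b) (f a)"])
    fix a b assume [simp]: "a \<in> carrier G" "b \<in> carrier G"
    have "inv (f (a \<otimes>\<^bsub>G\<^esub> b)) = inv (?\<beta> a b) \<otimes> (inv (f b) \<otimes> inv (f a))"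
      by (simp add: q_map_cross[OF f] inv_mult_group)
    also have "\<dots> = inv (f b) \<otimes> inv (f a) \<otimes> inv (?\<beta> a b)"
      by (intro D_central) simp_all
    also have "inv (f b) \<otimes> inv (f a) = inv (f a) \<otimes> inv (f b) \<otimes> commutator H (f b) (f a)"
      using mult_commute_commutator[of "inv (f b)" "inv (f a)"] by (simp add: commutator_inv)
    finally show "inv (f (a \<otimes>\<^bsub>G\<^esub> b)) =
        inv (f a) \<otimes> inv (f b) \<otimes> (inv (?\<beta> a b) \<otimes> commutator H (f b) (f a))"
      by (simp add: m_assoc D_commute)
  qed (use q_map_dom[OF f] in \<open>simp_all add: q_map_cross_mult[OF f] 
      q_map_commutator[OF f] m_assoc D_commute D_left_commute inv_mult_group\<close>)
qed

lemma q_map_cong: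
  assumes f: "q_map G H f" and eq: "\<And>x. x \<in> carrier G \<Longrightarrow> g x = f x"
  shows "q_map G H g"
proof -
  interpret G: group G using f by (simp add: q_map_def nil2_group_def)
  show ?thesis
    by (rule q_mapI[where \<beta> = "cross_effect G H f"])
       (use q_map_dom[OF f] q_map_closed[OF f] q_map_cross[OF f] q_map_cross_mult[OF f] in
        \<open>simp_all add: eq\<close>)
qed

lemma q_map_comp_hom:
  assumes f: "q_map G H f" and K: "nil2_group K" and h: "h \<in> hom K G"
  shows "q_map K H (\<lambda>x. f (h x))"
proof -
  interpret K: group K using K by (simp add: nil2_group_def)
  have [simp]: "h x \<in> carrier G" if "x \<in> carrier K" for x
    using h that by (rule hom_in_carrier)
  show ?thesis
    by (rule q_mapI[where \<beta> = "\<lambda>a b. cross_effect G H f (h a) (h b)"])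
       (use K q_map_closed[OF f] q_map_cross[OF f] q_map_cross_mult[OF f] in
        \<open>simp_all add: hom_mult[OF h]\<close>)
qed

lemma q_map_hom:
  assumes "nil2_group G" "h \<in> hom G H"
  shows "q_map G H h"
  by (rule q_mapI[where \<beta> = "\<lambda>a b. \<one>"])
     (use assms hom_in_carrier[OF assms(2)] in \<open>simp_all add: hom_mult[OF assms(2)]\<close>)

text \<open>Right cosets naturally compare by \<open>b \<otimes> inv a\<close>. Conjugation, under
  which \<open>D\<close> is stable, turns this into \<open>inv a \<otimes> b\<close>, the shape of
  the values of a connecting cochain.\<close>

lemma ab_proj_eq_iff:
  assumes "a \<in> carrier H" "b \<in> carrier H"
  shows "ab_proj H a = ab_proj H b \<longleftrightarrow> inv a \<otimes> b \<in> D"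
proof -
  interpret D: normal D H by (rule D_normal)
  have "ab_proj H a = ab_proj H b \<longleftrightarrow> b \<in> D #> a"
    using assms repr_independence[OF _ _ D_subgroup] rcos_self[OF _ D_subgroup]
    unfolding ab_proj_def by blast
  also have "\<dots> \<longleftrightarrow> b \<otimes> inv a \<in> D"
    using assms by (intro D.rcos_module) (simp_all add: group_axioms)
  also have "\<dots> \<longleftrightarrow> inv a \<otimes> b \<in> D"
    using assms D.inv_op_closed1[of a "b \<otimes> inv a"] D.inv_op_closed2[of a "inv a \<otimes> b"]
    by (auto simp: m_assoc)
  finally show ?thesis .
qed

lemma ab_proj_hom: "ab_proj H \<in> hom H (abelianization H)"
  unfolding ab_proj_def abelianization_def using normal.r_coset_hom_Mod[OF D_normal] .

lemma ab_proj_mult_D: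
  assumes "a \<in> carrier H" "d \<in> D"
  shows "ab_proj H (a \<otimes> d) = ab_proj H a"
  using assms ab_proj_eq_iff[of a "a \<otimes> d"] by (simp add: m_assoc[symmetric])

lemma commutator_group_simps [simp]:
  "carrier (commutator_group H) = D" "mult (commutator_group H) = mult H"
  "one (commutator_group H) = one H"
  by (simp_all add: commutator_group_def)

lemma inv_commutator_group [simp]: "a \<in> D \<Longrightarrow> inv\<^bsub>commutator_group H\<^esub> a = inv a"
  unfolding commutator_group_def using D_subgroup by (simp add: m_inv_consistent)

text \<open>For a \<open>D\<close>-valued map the cross effect lies in \<open>D\<close>, and it is
  the same whether computed in \<open>H\<close> or in the commutator group. As \<open>D\<close> is
  central, quadratic maps into \<open>[H, H]\<close> are then the \<open>D\<close>-valued q-maps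
  into \<open>H\<close>, so all calculations can take place in \<open>H\<close>.\<close>

lemma Quad_carrier_iff:
  assumes "nil2_group G"
  shows "f \<in> carrier (Quad G (commutator_group H)) \<longleftrightarrow> f \<in> carrier G \<rightarrow>\<^sub>E D \<and> q_map G H f"
proof (cases "f \<in> carrier G \<rightarrow>\<^sub>E D")
  case True
  interpret G: group G using assms by (simp add: nil2_group_def)
  have f: "f a \<in> D" if "a \<in> carrier G" for a using True that by auto
  have "cross_effect G (commutator_group H) f a b = cross_effect G H f a b"
    if "a \<in> carrier G" "b \<in> carrier G" for a b
    using that f by (simp add: cross_effect_def)
  moreover have "cross_effect G H f a b \<in> D" if "a \<in> carrier G" "b \<in> carrier G" for a b
    using that f by (simp add: cross_effect_def)
  ultimately show ?thesis
    using True assms nil2 f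
    by (auto simp: Quad_def quadratic_def weakly_quadratic_def q_map_def D_central Pi_iff)
qed (simp add: Quad_def)

end

section \<open>The cochain complex in low degrees\<close>

text \<open>Here \<open>n\<close> is the top coface index, one more than the degree of the cochain:
  the two cases serve the coboundaries out of degrees 0 and 1.\<close>

lemma (in comm_group) alternating_finprod:
  assumes a: "\<And>j. j \<le> n \<Longrightarrow> a j \<in> carrier G"
  shows "n = 1 \<Longrightarrow> finprod G (\<lambda>j. a j [^] ((- 1) ^ j :: int)) {..n} = a 0 \<otimes> inv (a 1)"
    "n = 2 \<Longrightarrow> finprod G (\<lambda>j. a j [^] ((- 1) ^ j :: int)) {..n} = a 0 \<otimes> inv (a 1) \<otimes> a 2"
proof -
  have pow: "a j [^] ((- 1) ^ j :: int) \<in> carrier G" if "j \<le> n" for j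
    using a[OF that] by simp
  have neg: "x [^] (- 1 :: int) = inv x" if "x \<in> carrier G" for x
    using int_pow_neg[OF that, of 1] that by simp
  show "finprod G (\<lambda>j. a j [^] ((- 1) ^ j :: int)) {..n} = a 0 \<otimes> inv (a 1)" if "n = 1"
    using a pow that by (simp add: neg finprod_Suc Pi_iff m_comm)
  show "finprod G (\<lambda>j. a j [^] ((- 1) ^ j :: int)) {..n} = a 0 \<otimes> inv (a 1) \<otimes> a 2" if "n = 2"
    using a pow that by (simp add: numeral_2_eq_2 neg finprod_Suc Pi_iff m_comm)
qed

section \<open>The abelian groups of quadratic maps into the commutator subgroup\<close>

context nil2
begin

abbreviation Q :: "'g monoid \<Rightarrow> ('g \<Rightarrow> 'h) monoid" where
  "Q G \<equiv> Quad G (commutator_group H)"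

lemma Quad_simps:
  "\<psi> \<otimes>\<^bsub>Q G\<^esub> \<psi>' = (\<lambda>x\<in>carrier G. \<psi> x \<otimes> \<psi>' x)" "\<one>\<^bsub>Q G\<^esub> = (\<lambda>x\<in>carrier G. \<one>)"
  by (simp_all add: Quad_def)

lemma Quad_memI:
  assumes "q_map G H \<psi>" and "\<And>x. x \<in> carrier G \<Longrightarrow> \<psi> x \<in> D"
  shows "(\<lambda>x\<in>carrier G. \<psi> x) \<in> carrier (Q G)"
  unfolding Quad_carrier_iff[OF q_map_dom[OF assms(1)]]
  using assms by (auto intro: q_map_cong[OF assms(1)])

lemma Quad_memD:
  assumes "nil2_group G" "\<psi> \<in> carrier (Q G)"
  shows "q_map G H \<psi>" "x \<in> carrier G \<Longrightarrow> \<psi> x \<in> D" "\<psi> \<in> extensional (carrier G)"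
  using assms(2) unfolding Quad_carrier_iff[OF assms(1)] by (auto simp: PiE_iff)

lemma Quad_inverse_mem:
  assumes "nil2_group G" "\<psi> \<in> carrier (Q G)"
  shows "(\<lambda>x\<in>carrier G. inv (\<psi> x)) \<in> carrier (Q G)"
  using Quad_memD[OF assms] by (intro Quad_memI q_map_inverse) auto

text \<open>Closure is inherited from q-maps into \<open>H\<close>. Commutativity holds because all
  values lie in the central subgroup \<open>D\<close>.\<close>

lemma Quad_comm_group:
  assumes G: "nil2_group G"
  shows "comm_group (Q G)"
proof (rule comm_groupI)
  note D = Quad_memD[OF G]
  show "\<one>\<^bsub>Q G\<^esub> \<in> carrier (Q G)"
    unfolding Quad_simps
    by (intro Quad_memI q_mapI[where \<beta> = "\<lambda>a b. \<one>"]) (use G in auto)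
  fix \<psi> assume \<psi>: "\<psi> \<in> carrier (Q G)"
  show "\<one>\<^bsub>Q G\<^esub> \<otimes>\<^bsub>Q G\<^esub> \<psi> = \<psi>"
    using D[OF \<psi>] by (intro extensionalityI[of _ "carrier G"]) (simp_all add: Quad_simps)
  show "\<exists>\<psi>'\<in>carrier (Q G). \<psi>' \<otimes>\<^bsub>Q G\<^esub> \<psi> = \<one>\<^bsub>Q G\<^esub>"
    using D[OF \<psi>] by (intro bexI[OF _ Quad_inverse_mem[OF G \<psi>]]) (simp add: Quad_simps cong: restrict_cong)
  fix \<psi>' assume \<psi>': "\<psi>' \<in> carrier (Q G)"
  show "\<psi> \<otimes>\<^bsub>Q G\<^esub> \<psi>' \<in> carrier (Q G)"
    unfolding Quad_simps using D[OF \<psi>] D[OF \<psi>'] by (intro Quad_memI q_map_mult) auto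
  show "\<psi> \<otimes>\<^bsub>Q G\<^esub> \<psi>' = \<psi>' \<otimes>\<^bsub>Q G\<^esub> \<psi>"
    using D[OF \<psi>] D[OF \<psi>'] by (simp add: Quad_simps D_commute cong: restrict_cong)
  fix \<psi>'' assume \<psi>'': "\<psi>'' \<in> carrier (Q G)"
  show "\<psi> \<otimes>\<^bsub>Q G\<^esub> \<psi>' \<otimes>\<^bsub>Q G\<^esub> \<psi>'' = \<psi> \<otimes>\<^bsub>Q G\<^esub> (\<psi>' \<otimes>\<^bsub>Q G\<^esub> \<psi>'')"
    using D[OF \<psi>] D[OF \<psi>'] D[OF \<psi>''] by (simp add: Quad_simps m_assoc cong: restrict_cong)
qed

lemma Quad_inv:
  assumes "nil2_group G" "\<psi> \<in> carrier (Q G)"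
  shows "inv\<^bsub>Q G\<^esub> \<psi> = (\<lambda>x\<in>carrier G. inv (\<psi> x))"
proof -
  interpret Q: comm_group "Q G" using assms(1) by (rule Quad_comm_group)
  show ?thesis
    by (rule Q.inv_equality)
       (use assms Quad_inverse_mem Quad_memD[OF assms] in \<open>simp_all add: Quad_simps cong: restrict_cong\<close>)
qed

section \<open>Coboundaries and connecting cochains\<close>

context
  fixes X :: "'a simplicial_data"
  assumes X: "simplicial_nil2_group X"
begin

lemma level_nil2: "nil2_group (level X n)"
  using X by (simp add: simplicial_nil2_group_def)

lemma face_hom: "i \<le> Suc n \<Longrightarrow> face X n i \<in> hom (level X (Suc n)) (level X n)"
  using X by (simp add: simplicial_nil2_group_def)

lemma face_closed: "i \<le> Suc n \<Longrightarrow> x \<in> carrier (level X (Suc n)) \<Longrightarrow> face X n i x \<in> carrier (level X n)"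
  using face_hom by (rule hom_in_carrier)

lemma face_face:
  "i < j \<Longrightarrow> j \<le> Suc (Suc n) \<Longrightarrow> x \<in> carrier (level X (Suc (Suc n))) \<Longrightarrow>
    face X n i (face X (Suc n) j x) = face X n (j - 1) (face X (Suc n) i x)"
  using X by (simp add: simplicial_nil2_group_def)

lemma quad_coface_mem:
  assumes "\<psi> \<in> carrier (Q (level X n))" "j \<le> Suc n"
  shows "quad_coface X n j \<psi> \<in> carrier (Q (level X (Suc n)))"
  unfolding quad_coface_def
  using Quad_memD[OF level_nil2 assms(1)] face_closed[OF assms(2)]
  by (intro Quad_memI q_map_comp_hom[OF _ level_nil2 face_hom] assms(2)) auto

lemma quad_coboundary_0:
  assumes \<psi>: "\<psi> \<in> carrier (Q (level X 0))"
  shows "quad_coboundary X (commutator_group H) 0 \<psi> =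
    (\<lambda>x\<in>carrier (level X 1). \<psi> (face X 0 0 x) \<otimes> inv (\<psi> (face X 0 1 x)))"
proof -
  interpret Q: comm_group "Q (level X 1)" by (rule Quad_comm_group[OF level_nil2])
  show ?thesis
    using quad_coface_mem[OF \<psi>] Quad_memD(2)[OF level_nil2 \<psi>] face_closed[of _ 0]
    by (simp add: quad_coboundary_def Q.alternating_finprod(1)[simplified]
        Quad_inv[OF level_nil2] Quad_simps quad_coface_def cong: restrict_cong)
qed

lemma quad_coboundary_1:
  assumes \<psi>: "\<psi> \<in> carrier (Q (level X 1))"
  shows "quad_coboundary X (commutator_group H) 1 \<psi> =
    (\<lambda>x\<in>carrier (level X 2). \<psi> (face X 1 0 x) \<otimes> inv (\<psi> (face X 1 1 x)) \<otimes> \<psi> (face X 1 2 x))"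
proof -
  interpret Q: comm_group "Q (level X 2)" by (rule Quad_comm_group[OF level_nil2])
  show ?thesis
    using quad_coface_mem[OF \<psi>] Quad_memD(2)[OF level_nil2 \<psi>] face_closed[of _ 1]
    by (simp add: quad_coboundary_def Q.alternating_finprod(2)[simplified numeral_2_eq_2] numeral_2_eq_2
        Quad_inv[OF level_nil2] Quad_simps quad_coface_def cong: restrict_cong)
qed

text \<open>As a pointwise product of an inverse and a q-map, the cochain is a q-map into
  \<open>H\<close>. Hypothesis \<open>eq\<close> puts its values into \<open>D\<close>, which makes
  it quadratic into \<open>[H, H]\<close>.\<close>

lemma connecting_cochain_mem:
  assumes \<phi>: "q_map (level X 0) H \<phi>"
    and eq: "\<And>x. x \<in> carrier (level X 1) \<Longrightarrow> ab_proj H (\<phi> (face X 0 0 x)) = ab_proj H (\<phi> (face X 0 1 x))"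
  shows "connecting_cochain X H \<phi> \<in> carrier (Q (level X 1))"
  unfolding connecting_cochain_def
  using eq level_nil2 face_hom[of _ 0] face_closed[of _ 0] q_map_closed[OF \<phi>]
  by (intro Quad_memI q_map_mult q_map_inverse q_map_comp_hom[OF \<phi>]) (simp_all add: ab_proj_eq_iff)

text \<open>On a 2-simplex the cochain gives the quotients of the values of \<open>\<phi>\<close> at
  pairs of vertices, and the alternating product of such quotients telescopes.\<close>

lemma connecting_cochain_cocycle:
  assumes \<phi>: "q_map (level X 0) H \<phi>"
    and eq: "\<And>x. x \<in> carrier (level X 1) \<Longrightarrow> ab_proj H (\<phi> (face X 0 0 x)) = ab_proj H (\<phi> (face X 0 1 x))"
  shows "connecting_cochain X H \<phi> \<in> quad_cocycles X (commutator_group H) 1"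
proof -
  let ?c = "connecting_cochain X H \<phi>"
  have mem: "?c \<in> carrier (Q (level X 1))"
    using assms by (rule connecting_cochain_mem)
  have "?c (face X 1 0 x) \<otimes> inv (?c (face X 1 1 x)) \<otimes> ?c (face X 1 2 x) = \<one>"
    if x: "x \<in> carrier (level X 2)" for x
  proof -
    have f1: "face X 1 i x \<in> carrier (level X 1)" if "i \<le> 2" for i
      using face_closed[of i 1] that x by (simp add: numeral_2_eq_2)
    have f0: "face X 0 j (face X 1 i x) \<in> carrier (level X 0)" if "i \<le> 2" "j \<le> 1" for i j
      using face_closed[of j 0] that f1[of i] by simp
    \<comment> \<open>These are the values of \<open>\<phi>\<close> at the vertices 2, 1 and 0 of
      \<open>x\<close>. The simplicial identities reduce the other three iterated faces to
      these.\<close>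
    define a b c where "a = \<phi> (face X 0 0 (face X 1 0 x))" and "b = \<phi> (face X 0 1 (face X 1 0 x))"
      and "c = \<phi> (face X 0 1 (face X 1 1 x))"
    have [simp]: "a \<in> carrier H" "b \<in> carrier H" "c \<in> carrier H"
      using f0 q_map_closed[OF \<phi>] by (simp_all add: a_def b_def c_def)
    have "face X 0 0 (face X 1 1 x) = face X 0 0 (face X 1 0 x)"
      "face X 0 0 (face X 1 2 x) = face X 0 1 (face X 1 0 x)"
      "face X 0 1 (face X 1 2 x) = face X 0 1 (face X 1 1 x)"
      using face_face[of 0 1 0 x] face_face[of 0 2 0 x] face_face[of 1 2 0 x] x
      by (simp_all add: numeral_2_eq_2)
    then have c: "?c (face X 1 0 x) = inv a \<otimes> b" "?c (face X 1 1 x) = inv a \<otimes> c"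
      "?c (face X 1 2 x) = inv b \<otimes> c"
      using f1[of 0] f1[of 1] f1[of 2] by (simp_all add: connecting_cochain_def a_def b_def c_def)
    \<comment> \<open>The values of \<open>\<phi>\<close> need not commute, but those of the cochain
      lie in \<open>D\<close>. After this swap the product reads \<open>inv c \<otimes> a \<otimes>
      (inv a \<otimes> b) \<otimes> (inv b \<otimes> c)\<close> and collapses.\<close>
    then have "?c (face X 1 0 x) \<otimes> inv (?c (face X 1 1 x)) =
        inv (?c (face X 1 1 x)) \<otimes> ?c (face X 1 0 x)"
      by (intro D_commute D_inv Quad_memD(2)[OF level_nil2 mem] f1) simp_all
    then show ?thesis
      by (simp only: c) (simp add: m_assoc inv_mult_group)
  qed
  then have "quad_coboundary X (commutator_group H) 1 ?c = \<one>\<^bsub>Q (level X 2)\<^esub>"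
    unfolding quad_coboundary_1[OF mem] Quad_simps by (rule restrict_ext)
  then show ?thesis
    using mem by (simp add: quad_cocycles_def numeral_2_eq_2)
qed

text \<open>The correction is by \<open>inv (\<psi> x)\<close> because the signs differ: the
  coboundary inverts the value at \<open>d_1\<close>, the connecting cochain the one at
  \<open>d_0\<close>. Centrality of the values of \<open>\<psi>\<close> lets the two corrections be
  gathered in front.\<close>

lemma connecting_cochain_shift:
  assumes \<phi>: "q_map (level X 0) H \<phi>" and \<psi>: "\<psi> \<in> carrier (Q (level X 0))"
    and eq: "\<And>x. x \<in> carrier (level X 0) \<Longrightarrow> \<phi>' x = \<phi> x \<otimes> inv (\<psi> x)"
  shows "connecting_cochain X H \<phi>' =
    quad_coboundary X (commutator_group H) 0 \<psi> \<otimes>\<^bsub>Q (level X 1)\<^esub> connecting_cochain X H \<phi>"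
proof -
  have "inv (\<phi>' (face X 0 0 x)) \<otimes> \<phi>' (face X 0 1 x) =
      \<psi> (face X 0 0 x) \<otimes> inv (\<psi> (face X 0 1 x)) \<otimes> (inv (\<phi> (face X 0 0 x)) \<otimes> \<phi> (face X 0 1 x))"
    if x: "x \<in> carrier (level X 1)" for x
  proof -
    define a b p q where "a = \<phi> (face X 0 0 x)" and "b = \<phi> (face X 0 1 x)"
      and "p = \<psi> (face X 0 0 x)" and "q = \<psi> (face X 0 1 x)"
    have [simp]: "a \<in> carrier H" "b \<in> carrier H" "p \<in> D" "q \<in> D"
      using face_closed[of _ 0 x] x q_map_closed[OF \<phi>] Quad_memD(2)[OF level_nil2 \<psi>]
      by (simp_all add: a_def b_def p_def q_def)
    have "p \<otimes> inv a \<otimes> (b \<otimes> inv q) = p \<otimes> inv q \<otimes> (inv a \<otimes> b)"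
      using D_central[of "inv q" "inv a \<otimes> b"] by (simp add: m_assoc)
    then show ?thesis
      using eq face_closed[of _ 0 x] x unfolding a_def[symmetric] b_def[symmetric] p_def[symmetric]
        q_def[symmetric]
      by (simp add: inv_mult_group flip: a_def b_def[simplified] p_def q_def[simplified])
  qed
  then show ?thesis
    by (simp add: connecting_cochain_def quad_coboundary_0[OF \<psi>] Quad_simps cong: restrict_cong)
qed

end

end

section \<open>Lifting from free nil2-groups and the augmentation\<close>

context nil2
begin

text \<open>This admits the abelianization as a target in the universal property, whose uniqueness
  half is what compares the lifted map with the given one.\<close>

lemma abelianization_nil2: "nil2_group (abelianization H)"
proof -
  interpret A: comm_group "abelianization H"
    unfolding abelianization_def by (rule derived_quot_is_comm_group)
  show ?thesis by (rule A.abelian_nil2_group) (rule A.m_comm)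
qed

lemma ab_proj_surj: "ab_proj H ` carrier H = carrier (abelianization H)"
  by (simp add: ab_proj_def abelianization_def carrier_FactGroup)

end

text \<open>Preimages under \<open>p\<close> of the images of the generators determine a
  homomorphism into \<open>H\<close>. Composed with \<open>p\<close> it agrees with \<open>f\<close>
  on generators, hence everywhere by uniqueness.\<close>

lemma free_nil2_lift:
  fixes F :: "'a monoid" and H :: "('h, 'm) monoid_scheme" and K :: "('k, 'n) monoid_scheme"
  assumes F: "free_nil2 F" and H: "nil2_group H" and K: "nil2_group K"
    and p: "p \<in> hom H K" "p ` carrier H = carrier K" and f: "f \<in> hom F K"
  shows "\<exists>h\<in>hom F H. \<forall>x\<in>carrier F. p (h x) = f x"
proof -
  interpret F: group F using F by (simp add: free_nil2_def)
  obtain S :: "'a set" and e where e: "e \<in> iso F (free_nil2_group S)"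
    using F by (auto simp: free_nil2_def is_iso_def)
  define e' where "e' = inv_into (carrier F) e"
  have e'_iso: "e' \<in> iso (free_nil2_group S) F"
    unfolding e'_def using e by (rule F.iso_set_sym)
  then have e': "e' \<in> hom (free_nil2_group S) F" by (simp add: iso_def)
  have e_hom: "e \<in> hom F (free_nil2_group S)" using e by (simp add: iso_def)
  have e'e: "e' (e x) = x" if "x \<in> carrier F" for x
    using e that by (simp add: e'_def iso_def bij_betw_def)
  let ?gen = "\<lambda>s. word_class S [(True, s)]"
  have gen: "?gen s \<in> carrier (free_nil2_group S)" if "s \<in> S" for s
    using that by (simp add: free_nil2_group_def)
  have fe': "(\<lambda>A. f (e' A)) \<in> hom (free_nil2_group S) K"
    using hom_compose[OF e' f] by (simp add: comp_def)
  then have "f (e' (?gen s)) \<in> p ` carrier H" if "s \<in> S" for s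
    unfolding p(2) using gen[OF that] by (rule hom_in_carrier)
  then have "\<forall>s. \<exists>y. s \<in> S \<longrightarrow> y \<in> carrier H \<and> p y = f (e' (?gen s))"
    by (metis imageE)
  then obtain g where g: "\<And>s. s \<in> S \<Longrightarrow> g s \<in> carrier H \<and> p (g s) = f (e' (?gen s))"
    by metis
  then obtain h where h: "h \<in> hom (free_nil2_group S) H" "\<And>s. s \<in> S \<Longrightarrow> h (?gen s) = g s"
    using free_nil2_group_universal[OF H, of g S] by (auto simp: Pi_iff)
  have ph: "(\<lambda>A. p (h A)) \<in> hom (free_nil2_group S) K"
    using hom_compose[OF h(1) p(1)] by (simp add: comp_def)
  have "(\<lambda>s. f (e' (?gen s))) \<in> S \<rightarrow> carrier K"
    using gen hom_in_carrier[OF fe'] by blast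
  from free_nil2_group_universal[OF K this]
  obtain u where u: "\<And>h' A. h' \<in> hom (free_nil2_group S) K \<Longrightarrow>
      (\<And>s. s \<in> S \<Longrightarrow> h' (?gen s) = f (e' (?gen s))) \<Longrightarrow>
      A \<in> carrier (free_nil2_group S) \<Longrightarrow> h' A = u A"
    by blast
  \<comment> \<open>Both sides are homomorphisms with the same values on generators, so each equals
    \<open>u\<close>.\<close>
  have "p (h A) = f (e' A)" if "A \<in> carrier (free_nil2_group S)" for A
    using u[OF ph _ that] u[OF fe' _ that] h(2) g by simp
  then have "\<forall>x\<in>carrier F. p (h (e x)) = f x"
    using hom_in_carrier[OF e_hom] e'e by simp
  moreover have "(\<lambda>x. h (e x)) \<in> hom F H"
    using hom_compose[OF e_hom h(1)] by (simp add: comp_def)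
  ultimately show ?thesis by (intro bexI[of _ "\<lambda>x. h (e x)"])
qed

section \<open>The augmentation and its fibres\<close>

context
  fixes X :: "'a simplicial_data" and G :: "'g monoid" and \<theta>
  assumes X: "free_simplicial_resolution X G \<theta>"
begin

lemma resolution_simplicial: "simplicial_nil2_group X"
  using X by (simp add: free_simplicial_resolution_def)

interpretation L0: group "level X 0"
  using resolution_simplicial by (simp add: simplicial_nil2_group_def nil2_group_def)

interpretation L1: group "level X (Suc 0)"
  using resolution_simplicial by (simp add: simplicial_nil2_group_def nil2_group_def)

lemma d0_hom: "face X 0 0 \<in> hom (level X (Suc 0)) (level X 0)"
  using resolution_simplicial by (simp add: simplicial_nil2_group_def)

lemma d1_hom: "face X 0 (Suc 0) \<in> hom (level X (Suc 0)) (level X 0)"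
  using resolution_simplicial by (simp add: simplicial_nil2_group_def)

interpretation d0: group_hom "level X (Suc 0)" "level X 0" "face X 0 0"
  using d0_hom by unfold_locales

interpretation d1: group_hom "level X (Suc 0)" "level X 0" "face X 0 (Suc 0)"
  using d1_hom by unfold_locales

lemma s0_closed:
  assumes "x \<in> carrier (level X 0)"
  shows "degen X 0 0 x \<in> carrier (level X (Suc 0))"
proof (rule hom_in_carrier[OF _ assms])
  have "\<forall>n. \<forall>i\<le>n. degen X n i \<in> hom (level X n) (level X (Suc n))"
    using resolution_simplicial by (simp add: simplicial_nil2_group_def)
  then show "degen X 0 0 \<in> hom (level X 0) (level X (Suc 0))" by simp
qed

lemma face_s0:
  assumes "x \<in> carrier (level X 0)"
  shows "face X 0 0 (degen X 0 0 x) = x" "face X 0 (Suc 0) (degen X 0 0 x) = x"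
proof -
  have "\<forall>n j. \<forall>x\<in>carrier (level X n). j \<le> n \<longrightarrow>
      face X n j (degen X n j x) = x \<and> face X n (Suc j) (degen X n j x) = x"
    using resolution_simplicial by (simp add: simplicial_nil2_group_def)
  then show "face X 0 0 (degen X 0 0 x) = x" "face X 0 (Suc 0) (degen X 0 0 x) = x"
    using assms by auto
qed

lemma boundaries_0: "moore_boundaries X 0 = face X 0 (Suc 0) ` kernel (level X (Suc 0)) (level X 0) (face X 0 0)"
  by (simp add: moore_boundaries_def kernel_def)

text \<open>The boundaries are the image under \<open>d_1\<close> of the normal subgroup ker
  \<open>d_0\<close>, and \<open>d_1\<close> is onto because it is split by \<open>s_0\<close>.
  Concretely, conjugation by \<open>x\<close> downstairs is the image of conjugation by
  \<open>s_0 x\<close>, which preserves ker \<open>d_0\<close>.\<close>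

lemma boundaries_0_normal: "moore_boundaries X 0 \<lhd> level X 0"
proof -
  have sub: "subgroup (moore_boundaries X 0) (level X 0)"
    unfolding boundaries_0 by (intro d1.subgroup_img_is_subgroup d0.subgroup_kernel)
  moreover have "x \<otimes>\<^bsub>level X 0\<^esub> n \<otimes>\<^bsub>level X 0\<^esub> inv\<^bsub>level X 0\<^esub> x \<in> moore_boundaries X 0"
    if x: "x \<in> carrier (level X 0)" and n: "n \<in> moore_boundaries X 0" for x n
  proof -
    obtain z where z: "z \<in> kernel (level X (Suc 0)) (level X 0) (face X 0 0)" "n = face X 0 (Suc 0) z"
      using n unfolding boundaries_0 by blast
    let ?s = "degen X 0 0 x"
    let ?w = "?s \<otimes>\<^bsub>level X (Suc 0)\<^esub> z \<otimes>\<^bsub>level X (Suc 0)\<^esub> inv\<^bsub>level X (Suc 0)\<^esub> ?s"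
    have "?w \<in> kernel (level X (Suc 0)) (level X 0) (face X 0 0)"
      using z s0_closed[OF x] face_s0[OF x] x by (simp add: kernel_def)
    moreover have "x \<otimes>\<^bsub>level X 0\<^esub> n \<otimes>\<^bsub>level X 0\<^esub> inv\<^bsub>level X 0\<^esub> x = face X 0 (Suc 0) ?w"
      using z s0_closed[OF x] face_s0[OF x] by (simp add: kernel_def)
    ultimately show ?thesis unfolding boundaries_0 by (rule image_eqI[rotated])
  qed
  ultimately show ?thesis by (simp add: L0.normal_inv_iff)
qed

lemma homotopy_group_0: "homotopy_group X 0 = level X 0 Mod moore_boundaries X 0"
  by (simp add: homotopy_group_def)

lemma augmentation_hom: "augmentation X \<theta> \<in> hom (level X 0) G"
proof -
  have "\<theta> \<in> hom (level X 0 Mod moore_boundaries X 0) G"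
    using X by (simp add: free_simplicial_resolution_def homotopy_group_0 iso_def)
  from hom_compose[OF normal.r_coset_hom_Mod[OF boundaries_0_normal] this]
  show ?thesis by (simp add: augmentation_def[abs_def] comp_def)
qed

lemma augmentation_bij: "bij_betw \<theta> ((\<lambda>x. moore_boundaries X 0 #>\<^bsub>level X 0\<^esub> x) ` carrier (level X 0)) (carrier G)"
  using X by (simp add: free_simplicial_resolution_def homotopy_group_0 iso_def carrier_FactGroup)

lemma augmentation_surj: "augmentation X \<theta> ` carrier (level X 0) = carrier G"
  using augmentation_bij by (auto simp: augmentation_def[abs_def] bij_betw_def image_image)

text \<open>This is the coequalizer property on underlying sets: a single 1-simplex, rather than a
  chain of them, joins two points of a fibre. Multiplying by \<open>s_0 y\<close> or its inverse
  passes between elements of ker \<open>d_0\<close> and 1-simplices whose \<open>d_0\<close> is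
  \<open>y\<close>.\<close>

lemma augmentation_eq_iff:
  assumes x: "x \<in> carrier (level X 0)" and y: "y \<in> carrier (level X 0)"
  shows "augmentation X \<theta> x = augmentation X \<theta> y \<longleftrightarrow>
    (\<exists>z\<in>carrier (level X (Suc 0)). face X 0 0 z = y \<and> face X 0 (Suc 0) z = x)"
proof -
  interpret N: normal "moore_boundaries X 0" "level X 0" by (rule boundaries_0_normal)
  have "augmentation X \<theta> x = augmentation X \<theta> y \<longleftrightarrow>
      moore_boundaries X 0 #>\<^bsub>level X 0\<^esub> x = moore_boundaries X 0 #>\<^bsub>level X 0\<^esub> y"
    unfolding augmentation_def using x y augmentation_bij
    by (metis (no_types, lifting) bij_betw_def imageI inj_on_eq_iff)
  also have "\<dots> \<longleftrightarrow> x \<in> moore_boundaries X 0 #>\<^bsub>level X 0\<^esub> y"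
    using x y L0.repr_independence[OF _ _ N.subgroup_axioms] L0.rcos_self[OF _ N.subgroup_axioms] by blast
  also have "\<dots> \<longleftrightarrow> (\<exists>z\<in>carrier (level X (Suc 0)). face X 0 0 z = y \<and> face X 0 (Suc 0) z = x)"
  proof
    assume "x \<in> moore_boundaries X 0 #>\<^bsub>level X 0\<^esub> y"
    then obtain k where k: "k \<in> kernel (level X (Suc 0)) (level X 0) (face X 0 0)"
        "x = face X 0 (Suc 0) k \<otimes>\<^bsub>level X 0\<^esub> y"
      unfolding r_coset_def boundaries_0 by blast
    then show "\<exists>z\<in>carrier (level X (Suc 0)). face X 0 0 z = y \<and> face X 0 (Suc 0) z = x"
      using s0_closed[OF y] face_s0[OF y] y
      by (intro bexI[of _ "k \<otimes>\<^bsub>level X (Suc 0)\<^esub> degen X 0 0 y"]) (simp_all add: kernel_def)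
  next
    assume "\<exists>z\<in>carrier (level X (Suc 0)). face X 0 0 z = y \<and> face X 0 (Suc 0) z = x"
    then obtain z where z: "z \<in> carrier (level X (Suc 0))" "face X 0 0 z = y" "face X 0 (Suc 0) z = x" by blast
    let ?k = "z \<otimes>\<^bsub>level X (Suc 0)\<^esub> inv\<^bsub>level X (Suc 0)\<^esub> degen X 0 0 y"
    have "?k \<in> kernel (level X (Suc 0)) (level X 0) (face X 0 0)"
      using z s0_closed[OF y] face_s0[OF y] y by (simp add: kernel_def)
    moreover have "face X 0 (Suc 0) ?k \<otimes>\<^bsub>level X 0\<^esub> y = x"
      using z s0_closed[OF y] face_s0[OF y] y x by (simp add: L0.m_assoc)
    ultimately show "x \<in> moore_boundaries X 0 #>\<^bsub>level X 0\<^esub> y"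
      unfolding r_coset_def boundaries_0 by blast
  qed
  finally show ?thesis .
qed

lemma augmentation_faces:
  assumes "x \<in> carrier (level X 1)"
  shows "augmentation X \<theta> (face X 0 0 x) = augmentation X \<theta> (face X 0 1 x)"
  using assms augmentation_eq_iff[of "face X 0 1 x" "face X 0 0 x"] by auto

end

section \<open>The obstruction class\<close>

context nil2
begin

text \<open>A set-theoretic section \<open>s\<close> of \<open>p\<close> is not multiplicative, but
  \<open>\<phi>\<close> is constant on fibres and cannot distinguish
  \<open>s (a \<otimes> b)\<close> from \<open>s a \<otimes> s b\<close>. Hence the composite of
  \<open>\<phi>\<close> with \<open>s\<close> inherits the cross effect of \<open>\<phi>\<close> at
  \<open>s a\<close> and \<open>s b\<close>.\<close>

lemma q_map_descend:
  assumes \<phi>: "q_map L H \<phi>" and G: "nil2_group G"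
    and p: "p \<in> hom L G" "p ` carrier L = carrier G"
    and fib: "\<And>x y. x \<in> carrier L \<Longrightarrow> y \<in> carrier L \<Longrightarrow> p x = p y \<Longrightarrow> \<phi> x = \<phi> y"
  shows "\<exists>g. q_map G H g \<and> (\<forall>x\<in>carrier L. g (p x) = \<phi> x)"
proof -
  interpret L: group L using q_map_dom[OF \<phi>] by (simp add: nil2_group_def)
  interpret G: group G using G by (simp add: nil2_group_def)
  define s where "s = inv_into (carrier L) p"
  have s: "s a \<in> carrier L" "p (s a) = a" if "a \<in> carrier G" for a
    using that p(2) by (simp_all add: s_def inv_into_into f_inv_into_f)
  let ?\<beta> = "cross_effect L H \<phi>"
  have \<phi>s: "\<phi> (s (a \<otimes>\<^bsub>G\<^esub> b)) = \<phi> (s a \<otimes>\<^bsub>L\<^esub> s b)" if "a \<in> carrier G" "b \<in> carrier G" for a b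
    using that s by (intro fib) (simp_all add: hom_mult[OF p(1)])
  have \<beta>s: "?\<beta> (s a) (s b) = inv (\<phi> (s a) \<otimes> \<phi> (s b)) \<otimes> \<phi> (s (a \<otimes>\<^bsub>G\<^esub> b))"
    if "a \<in> carrier G" "b \<in> carrier G" for a b
    using that by (simp add: cross_effect_def \<phi>s)
  \<comment> \<open>Biadditivity has \<open>s\<close> of a product as an argument of the cross
    effect, so fibre constancy is also required at threefold products.\<close>
  have \<phi>s3: "\<phi> (s (a \<otimes>\<^bsub>G\<^esub> b) \<otimes>\<^bsub>L\<^esub> s c) = \<phi> (s a \<otimes>\<^bsub>L\<^esub> s b \<otimes>\<^bsub>L\<^esub> s c)"
    "\<phi> (s a \<otimes>\<^bsub>L\<^esub> s (b \<otimes>\<^bsub>G\<^esub> c)) = \<phi> (s a \<otimes>\<^bsub>L\<^esub> (s b \<otimes>\<^bsub>L\<^esub> s c))"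
    if "a \<in> carrier G" "b \<in> carrier G" "c \<in> carrier G" for a b c
    using that s by (intro fib; simp add: hom_mult[OF p(1)])+
  have "q_map G H (\<lambda>a. \<phi> (s a))"
  proof (rule q_mapI[where \<beta> = "\<lambda>a b. ?\<beta> (s a) (s b)"])
    fix a b c assume abc: "a \<in> carrier G" "b \<in> carrier G" "c \<in> carrier G"
    have "?\<beta> (s (a \<otimes>\<^bsub>G\<^esub> b)) (s c) = ?\<beta> (s a \<otimes>\<^bsub>L\<^esub> s b) (s c)"
      using abc by (simp add: cross_effect_def \<phi>s \<phi>s3)
    then show "?\<beta> (s (a \<otimes>\<^bsub>G\<^esub> b)) (s c) = ?\<beta> (s a) (s c) \<otimes> ?\<beta> (s b) (s c)"
      using abc s by (simp add: q_map_cross_mult[OF \<phi>])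
    have "?\<beta> (s a) (s (b \<otimes>\<^bsub>G\<^esub> c)) = ?\<beta> (s a) (s b \<otimes>\<^bsub>L\<^esub> s c)"
      using abc by (simp add: cross_effect_def \<phi>s \<phi>s3)
    then show "?\<beta> (s a) (s (b \<otimes>\<^bsub>G\<^esub> c)) = ?\<beta> (s a) (s b) \<otimes> ?\<beta> (s a) (s c)"
      using abc s by (simp add: q_map_cross_mult[OF \<phi>])
  qed (use G s q_map_closed[OF \<phi>] q_map_cross[OF \<phi>] \<phi>s in auto)
  moreover have "\<phi> (s (p x)) = \<phi> x" if x: "x \<in> carrier L" for x
    using x s[OF hom_in_carrier[OF p(1) x]] by (intro fib) simp_all
  ultimately show ?thesis by blast
qed

section \<open>Lifts, their cochains and the obstruction for a fixed resolution\<close>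

context
  fixes X :: "'a simplicial_data" and G :: "'g monoid" and \<theta> and f :: "'g \<Rightarrow> 'h set"
  assumes X: "free_simplicial_resolution X G \<theta>"
begin

text \<open>Level 0 is free and \<open>H\<close> maps onto its abelianization, so the lift can even
  be taken to be a homomorphism, which is a q-map with trivial cross effect.\<close>

lemma connecting_lift_exists:
  assumes f: "f \<in> hom G (abelianization H)"
  shows "\<exists>\<phi>. connecting_lift X \<theta> H f \<phi>"
proof -
  have free: "free_nil2 (level X 0)"
    using X by (simp add: free_simplicial_resolution_def)
  have "(\<lambda>x. f (augmentation X \<theta> x)) \<in> hom (level X 0) (abelianization H)"
    using Group.hom_compose[OF augmentation_hom[OF X] f] by (simp add: comp_def)
  from free_nil2_lift[OF free nil2 abelianization_nil2 ab_proj_hom ab_proj_surj this]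
  show ?thesis
    using q_map_hom[OF level_nil2[OF resolution_simplicial[OF X]]] by (auto simp: connecting_lift_def)
qed

lemma connecting_lift_faces:
  assumes "connecting_lift X \<theta> H f \<phi>" "x \<in> carrier (level X 1)"
  shows "ab_proj H (\<phi> (face X 0 0 x)) = ab_proj H (\<phi> (face X 0 1 x))"
  using assms augmentation_faces[OF X assms(2)]
    face_closed[OF resolution_simplicial[OF X], of 0 0 x] face_closed[OF resolution_simplicial[OF X], of 1 0 x]
  by (simp add: connecting_lift_def)

lemma connecting_lift_cocycle:
  assumes "connecting_lift X \<theta> H f \<phi>"
  shows "connecting_cochain X H \<phi> \<in> quad_cocycles X (commutator_group H) 1"
  using assms connecting_lift_faces[OF assms]
  by (intro connecting_cochain_cocycle[OF resolution_simplicial[OF X]]) (simp_all add: connecting_lift_def)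

lemma quad_class_connecting_cochain:
  assumes \<phi>: "connecting_lift X \<theta> H f \<phi>"
  shows "quad_class X (commutator_group H) 1 (connecting_cochain X H \<phi>) =
    connecting_cochain X H ` {\<phi>'. connecting_lift X \<theta> H f \<phi>'}"
proof -
  note S = resolution_simplicial[OF X]
  have q: "q_map (level X 0) H \<phi>" using \<phi> by (simp add: connecting_lift_def)
  have class_eq: "quad_class X (commutator_group H) 1 (connecting_cochain X H \<phi>) =
      (\<lambda>\<psi>. quad_coboundary X (commutator_group H) 0 \<psi> \<otimes>\<^bsub>Q (level X 1)\<^esub> connecting_cochain X H \<phi>) `
        carrier (Q (level X 0))"
    by (auto simp: quad_class_def r_coset_def)
  show ?thesis
    unfolding class_eq
  proof (intro equalityI subsetI; elim imageE)
    fix c \<psi> assume \<psi>: "\<psi> \<in> carrier (Q (level X 0))"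
      and c: "c = quad_coboundary X (commutator_group H) 0 \<psi> \<otimes>\<^bsub>Q (level X 1)\<^esub> connecting_cochain X H \<phi>"
    note m = Quad_memD[OF level_nil2[OF S] \<psi>]
    have "connecting_lift X \<theta> H f (\<lambda>x. \<phi> x \<otimes> inv (\<psi> x))"
      using \<phi> q_map_mult[OF q q_map_inverse[OF m(1)]] q_map_closed[OF q] m(2)
      by (simp add: connecting_lift_def ab_proj_mult_D)
    then show "c \<in> connecting_cochain X H ` {\<phi>'. connecting_lift X \<theta> H f \<phi>'}"
      unfolding c connecting_cochain_shift[OF S q \<psi> HOL.refl, symmetric] by blast
  next
    fix c \<phi>' assume \<phi>': "\<phi>' \<in> {\<phi>'. connecting_lift X \<theta> H f \<phi>'}" and c: "c = connecting_cochain X H \<phi>'"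
    have q': "q_map (level X 0) H \<phi>'" using \<phi>' by (simp add: connecting_lift_def)
    have D: "inv (\<phi>' x) \<otimes> \<phi> x \<in> D" if "x \<in> carrier (level X 0)" for x
      using that \<phi> \<phi>' q_map_closed[OF q] q_map_closed[OF q'] ab_proj_eq_iff[of "\<phi>' x" "\<phi> x"]
      by (simp add: connecting_lift_def)
    \<comment> \<open>This is the solution of
      \<open>\<phi>' x = \<phi> x \<otimes> inv (\<psi> x)\<close>. It is \<open>D\<close>-valued
      because both lifts have the same projection.\<close>
    let ?\<psi> = "\<lambda>x\<in>carrier (level X 0). inv (\<phi>' x) \<otimes> \<phi> x"
    have "?\<psi> \<in> carrier (Q (level X 0))"
      by (intro Quad_memI q_map_mult q_map_inverse q q' D)
    moreover from this have "c = quad_coboundary X (commutator_group H) 0 ?\<psi> \<otimes>\<^bsub>Q (level X 1)\<^esub> connecting_cochain X H \<phi>"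
      unfolding c
      by (rule connecting_cochain_shift[OF S q])
         (use q_map_closed[OF q] q_map_closed[OF q'] in \<open>simp add: inv_mult_group\<close>)
    ultimately show "c \<in> (\<lambda>\<psi>. quad_coboundary X (commutator_group H) 0 \<psi> \<otimes>\<^bsub>Q (level X 1)\<^esub> connecting_cochain X H \<phi>) `
        carrier (Q (level X 0))"
      by blast
  qed
qed

text \<open>The set on the right does not mention any particular lift, so every lift yields this
  class; this is the uniqueness that the definite description requires.\<close>

lemma obstruction_eq:
  assumes f: "f \<in> hom G (abelianization H)"
  shows "obstruction X \<theta> H f = connecting_cochain X H ` {\<phi>. connecting_lift X \<theta> H f \<phi>}"
  unfolding obstruction_def
  using connecting_lift_exists[OF f] quad_class_connecting_cochain
  by (intro the_equality) auto

lemma trivial_coboundary: "\<one>\<^bsub>Q (level X 1)\<^esub> \<in> quad_coboundaries X (commutator_group H) 1"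
proof -
  note S = resolution_simplicial[OF X]
  interpret Q: comm_group "Q (level X 0)" by (rule Quad_comm_group[OF level_nil2[OF S]])
  have "quad_coboundary X (commutator_group H) 0 \<one>\<^bsub>Q (level X 0)\<^esub> = \<one>\<^bsub>Q (level X 1)\<^esub>"
    using face_closed[OF S, of _ 0] quad_coboundary_0[OF S Q.one_closed]
    by (simp add: Quad_simps cong: restrict_cong)
  then show ?thesis
    using Q.one_closed by (auto simp: image_iff intro!: bexI[of _ "\<one>\<^bsub>Q (level X 0)\<^esub>"])
qed

lemma quad_coboundaries_subset: "quad_coboundaries X (commutator_group H) 1 \<subseteq> carrier (Q (level X 1))"
proof -
  note S = resolution_simplicial[OF X]
  interpret Q: comm_group "Q (level X (Suc 0))" by (rule Quad_comm_group[OF level_nil2[OF S]])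
  have "quad_coboundary X (commutator_group H) 0 \<psi> \<in> carrier (Q (level X 1))"
    if "\<psi> \<in> carrier (Q (level X 0))" for \<psi>
    using that quad_coface_mem[OF S, of \<psi> 0] unfolding quad_coboundary_def One_nat_def
    by (intro Q.finprod_closed Pi_I Q.int_pow_closed) simp
  then show ?thesis by auto
qed

lemma obstruction_trivial_iff:
  assumes G: "nil2_group G" and f: "f \<in> hom G (abelianization H)"
  shows "obstruction X \<theta> H f = quad_coboundaries X (commutator_group H) 1 \<longleftrightarrow>
    (\<exists>g. q_map G H g \<and> (\<forall>x\<in>carrier G. ab_proj H (g x) = f x))"
proof
  note S = resolution_simplicial[OF X]
  interpret Q: comm_group "Q (level X 1)" by (rule Quad_comm_group[OF level_nil2[OF S]])
  note aug = augmentation_hom[OF X] augmentation_surj[OF X]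
  {
    assume "obstruction X \<theta> H f = quad_coboundaries X (commutator_group H) 1"
    \<comment> \<open>The zero class contains the neutral cochain. Since the class consists of
      cochains of lifts, some lift has exactly this cochain, not merely a cohomologous one.\<close>
    then have "\<one>\<^bsub>Q (level X 1)\<^esub> \<in> connecting_cochain X H ` {\<phi>. connecting_lift X \<theta> H f \<phi>}"
      using trivial_coboundary obstruction_eq[OF f] by simp
    then obtain \<phi> where \<phi>: "connecting_lift X \<theta> H f \<phi>" "connecting_cochain X H \<phi> = \<one>\<^bsub>Q (level X 1)\<^esub>"
      by auto
    have q: "q_map (level X 0) H \<phi>" using \<phi>(1) by (simp add: connecting_lift_def)
    have "\<phi> (face X 0 1 z) = \<phi> (face X 0 0 z)" if z: "z \<in> carrier (level X 1)" for z
    proof -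
      have "inv (\<phi> (face X 0 0 z)) \<otimes> \<phi> (face X 0 1 z) = \<one>"
        using fun_cong[OF \<phi>(2), of z] z by (simp add: connecting_cochain_def Quad_simps)
      then show ?thesis
        using q_map_closed[OF q] face_closed[OF S, of _ 0] z
          l_cancel_inv(1)[of "\<phi> (face X 0 0 z)" "\<phi> (face X 0 1 z)"] by simp
    qed
    \<comment> \<open>Points of one fibre of the augmentation are the two faces of a 1-simplex, and
      \<open>\<phi>\<close> takes equal values on these.\<close>
    then have "\<phi> x = \<phi> y" if "x \<in> carrier (level X 0)" "y \<in> carrier (level X 0)"
      "augmentation X \<theta> x = augmentation X \<theta> y" for x y
      using that augmentation_eq_iff[OF X that(1,2)] by auto
    then obtain g where g: "q_map G H g" "\<And>x. x \<in> carrier (level X 0) \<Longrightarrow> g (augmentation X \<theta> x) = \<phi> x"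
      using q_map_descend[OF q G aug] by blast
    then have "\<forall>x\<in>carrier G. ab_proj H (g x) = f x"
      using \<phi>(1) unfolding aug(2)[symmetric] by (simp add: connecting_lift_def)
    then show "\<exists>g. q_map G H g \<and> (\<forall>x\<in>carrier G. ab_proj H (g x) = f x)"
      using g(1) by blast
  next
    assume "\<exists>g. q_map G H g \<and> (\<forall>x\<in>carrier G. ab_proj H (g x) = f x)"
    then obtain g where g: "q_map G H g" "\<And>x. x \<in> carrier G \<Longrightarrow> ab_proj H (g x) = f x" by blast
    \<comment> \<open>The augmentation identifies the two faces of each 1-simplex, so this lift has
      the neutral cochain, whose coset is the subgroup of coboundaries itself.\<close>
    let ?\<phi> = "\<lambda>x. g (augmentation X \<theta> x)"
    have \<phi>: "connecting_lift X \<theta> H f ?\<phi>"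
      using q_map_comp_hom[OF g(1) level_nil2[OF S] aug(1)] g(2) hom_in_carrier[OF aug(1)]
      by (simp add: connecting_lift_def)
    have "connecting_cochain X H ?\<phi> = \<one>\<^bsub>Q (level X 1)\<^esub>"
      using augmentation_faces[OF X] face_closed[OF S, of _ 0] q_map_closed[OF g(1)] hom_in_carrier[OF aug(1)]
      by (simp add: connecting_cochain_def Quad_simps cong: restrict_cong)
    then show "obstruction X \<theta> H f = quad_coboundaries X (commutator_group H) 1"
      using quad_class_connecting_cochain[OF \<phi>] obstruction_eq[OF f]
        Q.coset_mult_one[OF quad_coboundaries_subset] by (simp add: quad_class_def)
  }
qed

end

section \<open>Change of resolution\<close>

lemma connecting_lift_pullback:
  assumes X: "simplicial_nil2_group X" and Y: "simplicial_nil2_group Y"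
    and t: "resolution_map Y \<eta> X \<theta> t" and \<phi>: "connecting_lift X \<theta> H f \<phi>"
  shows "connecting_lift Y \<eta> H f (\<lambda>y. \<phi> (t 0 y))"
    and "(\<lambda>y\<in>carrier (level Y 1). connecting_cochain X H \<phi> (t 1 y)) =
      connecting_cochain Y H (\<lambda>y. \<phi> (t 0 y))"
proof -
  have hom: "t n \<in> hom (level Y n) (level X n)" for n
    using t by (simp add: resolution_map_def)
  have aug: "augmentation X \<theta> (t 0 y) = augmentation Y \<eta> y" if "y \<in> carrier (level Y 0)" for y
    using t that by (simp add: resolution_map_def)
  have face: "face X 0 j (t 1 y) = t 0 (face Y 0 j y)" if "j \<le> 1" "y \<in> carrier (level Y 1)" for j y
    using t that by (simp add: resolution_map_def)
  show "connecting_lift Y \<eta> H f (\<lambda>y. \<phi> (t 0 y))"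
    using \<phi> q_map_comp_hom[OF _ level_nil2[OF Y] hom] aug hom_in_carrier[OF hom]
    by (simp add: connecting_lift_def)
  show "(\<lambda>y\<in>carrier (level Y 1). connecting_cochain X H \<phi> (t 1 y)) =
      connecting_cochain Y H (\<lambda>y. \<phi> (t 0 y))"
    using face hom_in_carrier[OF hom] by (simp add: connecting_cochain_def cong: restrict_cong)
qed

text \<open>Every cochain in the class comes from a lift \<open>\<phi>\<close>, and its pullback is
  the cochain of the lift obtained by composing \<open>\<phi>\<close> with \<open>t 0\<close>. So
  every member of the union in \<open>quad_cohomology_map\<close> is already the obstruction on
  \<open>Y\<close>.\<close>

lemma obstruction_natural:
  assumes X: "free_simplicial_resolution X G \<theta>" and Y: "free_simplicial_resolution Y G \<eta>"
    and t: "resolution_map Y \<eta> X \<theta> t" and f: "f \<in> hom G (abelianization H)"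
  shows "quad_cohomology_map Y (commutator_group H) 1 t (obstruction X \<theta> H f) = obstruction Y \<eta> H f"
proof -
  have "quad_class Y (commutator_group H) 1 (\<lambda>y\<in>carrier (level Y 1). connecting_cochain X H \<phi> (t 1 y)) =
      obstruction Y \<eta> H f" if "connecting_lift X \<theta> H f \<phi>" for \<phi>
    using connecting_lift_pullback[OF resolution_simplicial[OF X] resolution_simplicial[OF Y] t that]
      quad_class_connecting_cochain[OF Y] obstruction_eq[OF Y f] by simp
  then show ?thesis
    \<comment> \<open>A lift exists, so the union runs over a nonempty set and equals the common
      value.\<close>
    using connecting_lift_exists[OF X f] by (auto simp: quad_cohomology_map_def obstruction_eq[OF X f])
qed

end

theorem corollary9p4:
  fixes G :: "'g monoid" and H :: "'h monoid" and f :: "'g \<Rightarrow> 'h set"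
    and X :: "'a simplicial_data" and \<theta> :: "'a set \<Rightarrow> 'g"
  assumes "nil2_group G" and "nil2_group H"
    and "f \<in> hom G (abelianization H)"
    and "free_simplicial_resolution X G \<theta>"
  shows
    \<comment> \<open>the connecting construction is possible, and its result does not depend on the lift\<close>
    "(\<exists>\<phi>. connecting_lift X \<theta> H f \<phi>) \<and>
     (\<forall>\<phi>. connecting_lift X \<theta> H f \<phi> \<longrightarrow>
        connecting_cochain X H \<phi> \<in> quad_cocycles X (commutator_group H) 1 \<and>
        quad_class X (commutator_group H) 1 (connecting_cochain X H \<phi>) = obstruction X \<theta> H f) \<and>
     obstruction X \<theta> H f \<in> carrier (quad_cohomology X (commutator_group H) 1) \<and>
     \<comment> \<open>nor, under comparison of resolutions, on the resolution\<close>
     (\<forall>(Y :: 'b simplicial_data) \<eta> t.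
        free_simplicial_resolution Y G \<eta> \<and> resolution_map Y \<eta> X \<theta> t \<longrightarrow>
        quad_cohomology_map Y (commutator_group H) 1 t (obstruction X \<theta> H f) = obstruction Y \<eta> H f) \<and>
     \<comment> \<open>vanishing criterion\<close>
     (obstruction X \<theta> H f = \<one>\<^bsub>quad_cohomology X (commutator_group H) 1\<^esub> \<longleftrightarrow>
        (\<exists>g. q_map G H g \<and> (\<forall>x\<in>carrier G. ab_proj H (g x) = f x)))"
proof -
  interpret nil2 H
    using assms(2) by (simp add: nil2_def nil2_axioms_def nil2_group_def)
  note f = assms(3) and X = assms(4)
  have class_eq: "quad_class X (commutator_group H) 1 (connecting_cochain X H \<phi>) = obstruction X \<theta> H f"
    if "connecting_lift X \<theta> H f \<phi>" for \<phi>
    using quad_class_connecting_cochain[OF X that] obstruction_eq[OF X f] by simp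
  obtain \<phi> where \<phi>: "connecting_lift X \<theta> H f \<phi>"
    using connecting_lift_exists[OF X f] by blast
  have "obstruction X \<theta> H f \<in> carrier (quad_cohomology X (commutator_group H) 1)"
    using connecting_lift_cocycle[OF X \<phi>] class_eq[OF \<phi>]
    by (auto simp: quad_cohomology_def carrier_FactGroup quad_class_def r_coset_def)
  \<comment> \<open>The neutral element of the factor group is the coset of coboundaries, the form
    in which the vanishing criterion was proved.\<close>
  moreover have "\<one>\<^bsub>quad_cohomology X (commutator_group H) 1\<^esub> = quad_coboundaries X (commutator_group H) 1"
    by (simp add: quad_cohomology_def)
  ultimately show ?thesis
    using \<phi> class_eq connecting_lift_cocycle[OF X] obstruction_natural[OF X _ _ f]
      obstruction_trivial_iff[OF X assms(1) f]
    by (intro conjI allI impI) (simp_all only:, blast+)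
qed

end
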